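(* Let $R:(\mathcal C\times\mathcal C)^{op}\to\mathsf{Pos}$ be an extensional relational doctrine with quotients. Then the following are equivalent: (1) every quotient arrow in $\mathcal C$ splits (i.e. has a section); (2) for every monad $\mathbb T=\langle T,\eta,\mu\rangle$ on $R$ in $\mathbf{RD}$, the relational doctrine $R^{\mathbb T}$ has quotients and $\mathcal C_{\widehat{\mathbb T}}$ is an $R^{\mathbb T}$-projective cover.
   Context: A relational doctrine consists of a category $\mathcal C$ (its base) and a functor $R:(\mathcal C\times\mathcal C)^{op}\to\mathsf{Pos}$ (posets and monotone maps; $R_{f,g}:R(X,Y)\to R(A,B)$ for $f:A\to X$, $g:B\to Y$), together with monotone maps $;:R(X,Y)\times R(Y,Z)\to R(X,Z)$, elements $\mathsf d_X\in R(X,X)$ and monotone maps $(-)^\bot:R(X,Y)\to R(Y,X)$ such that $\alpha;(\beta;\gamma)=(\alpha;\beta);\gamma$, $\mathsf d_X;\alpha=\alpha=\alpha;\mathsf d_Y$, $(\alpha;\beta)^\bot=\beta^\bot;\alpha^\bot$, $\mathsf d_X^\bot=\mathsf d_X$, $\alpha^{\bot\bot}=\alpha$, and $R_{f,g}(\alpha);R_{g,h}(\beta)\le R_{f,h}(\alpha;\beta)$, $\mathsf d_A\le R_{f,f}(\mathsf d_X)$ for $f:A\to X$, $(R_{f,g}(\alpha))^\bot\le R_{g,f}(\alpha^\bot)$. The graph of $f:X\to Y$ is $\Gamma_f=R_{f,\mathrm{id}_Y}(\mathsf d_Y)\in R(X,Y)$. $R$ is extensional if $\Gamma_f=\Gamma_g$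 implies $f=g$ for all parallel $f,g$. Quotients. An $R$-equivalence relation on $X$ is $\rho\in R(X,X)$ with $\mathsf d_X\le\rho$, $\rho^\bot\le\rho$, $\rho;\rho\le\rho$. A quotient arrow of $\rho$ is $q:X\to W$ with $\rho\le\Gamma_q;\Gamma_q^\bot$ such that for every $f:X\to Z$ with $\rho\le\Gamma_f;\Gamma_f^\bot$ there is a unique $h:W\to Z$ with $f=h\circ q$; it is effective if $\rho=\Gamma_q;\Gamma_q^\bot$ and descent if $\Gamma_q^\bot;\Gamma_q=\mathsf d_W$. $R$ has quotients if every $R$-equivalence relation has an effective descent quotient arrow. "Quotient arrow" without further specification means quotient arrow of some $R$-equivalence relation. If $R$ has quotients, an object $P$ is $R$-projective if for every $f:P\to Y$ and every quotient arrow $q:X\to Y$ there is $h:P\to X$ with $f=q\circ h$. An $R$-projective cover is a full subcategory of the base all of whose objects are $R$-projective and such that every object $X$ of the base admits a quotient arrow $P\to X$ with $P$ in that subcategory. 2-category $\mathbf{RD}$. A 1-arrow $F:R\to S$ of relational doctrines (bases $\mathcal C,\mathcal D$) is a pair $\langle\widehat F,\overline F\rangle$ of a functor $\widehat F:\mathcal C\to\mathcal D$ and a natural family of monotone maps $\overline F_{X,Y}:R(X,Y)\to S(\widehat FX,\widehat FY)$ preserving $\mathsf d$, $;$ and $(-)^\bot$. A 2-arrow $\theta:F\Rightarrow G$ is a natural transformation $\theta:\widehat F\to\widehat G$ with $\overline F_{X,Y}(\alpha)\le S_{\theta_X,\theta_Y}(\overline G_{X,Y}(\alpha))$ for all $\alpha$.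 Monads. A monad $\mathbb T=\langle T,\eta,\mu\rangle$ on $R$ in $\mathbf{RD}$ is a 1-arrow $T=\langle\widehat T,\overline T\rangle:R\to R$ with 2-arrows $\eta:\mathrm{Id}\Rightarrow T$, $\mu:T\circ T\Rightarrow T$ such that $\widehat{\mathbb T}=\langle\widehat T,\eta,\mu\rangle$ is a monad on the category $\mathcal C$. The Eilenberg–Moore doctrine $R^{\mathbb T}$ has as base the Eilenberg–Moore category $\mathcal C^{\widehat{\mathbb T}}$, with fibres $R^{\mathbb T}(\langle X,a\rangle,\langle Y,b\rangle)=\{\alpha\in R(X,Y)\mid\Gamma_a^\bot;\overline T_{X,Y}(\alpha);\Gamma_b\le\alpha\}$, with reindexing $R^{\mathbb T}_{f,g}=R_{f,g}$ and the relational operations of $R$. $\mathcal C_{\widehat{\mathbb T}}$ is the full subcategory of $\mathcal C^{\widehat{\mathbb T}}$ on the free algebras $\langle\widehat TX,\mu_X\rangle$ with $X$ in $\mathcal C$. *)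

theory Defs
  imports Main
begin

text \<open>
  Hom-sets and fibres need not be disjoint, so every operation carries the objects it is
  taken at: \<open>Cmp C X Y Z g f\<close> is \<open>g \<circ> f\<close> for \<open>f : X \<rightarrow> Y\<close> and \<open>g : Y \<rightarrow> Z\<close>.  This lets
  the homs of a category of algebras, and the fibres of a doctrine over it, be literal
  subsets of the original ones.  Values outside the carriers are irrelevant.
\<close>

record ('o, 'a) cat =
  Obj :: "'o set"
  Hom :: "'o \<Rightarrow> 'o \<Rightarrow> 'a set"
  Ident :: "'o \<Rightarrow> 'a"
  Cmp :: "'o \<Rightarrow> 'o \<Rightarrow> 'o \<Rightarrow> 'a \<Rightarrow> 'a \<Rightarrow> 'a"

abbreviation arr :: "('o, 'a) cat \<Rightarrow> 'o \<Rightarrow> 'o \<Rightarrow> 'a \<Rightarrow> bool" where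
  "arr C X Y f \<equiv> X \<in> Obj C \<and> Y \<in> Obj C \<and> f \<in> Hom C X Y"

locale category =
  fixes C :: "('o, 'a) cat"
  assumes ident_arr: "X \<in> Obj C \<Longrightarrow> Ident C X \<in> Hom C X X"
    and cmp_arr: "arr C X Y f \<Longrightarrow> arr C Y Z g \<Longrightarrow> Cmp C X Y Z g f \<in> Hom C X Z"
    and cmp_ident_right: "arr C X Y f \<Longrightarrow> Cmp C X X Y f (Ident C X) = f"
    and cmp_ident_left: "arr C X Y f \<Longrightarrow> Cmp C X Y Y (Ident C Y) f = f"
    and cmp_assoc: "arr C X Y f \<Longrightarrow> arr C Y Z g \<Longrightarrow> arr C Z W h \<Longrightarrow>
      Cmp C X Y W (Cmp C Y Z W h g) f = Cmp C X Z W h (Cmp C X Y Z g f)"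

definition full_subcategory :: "('o, 'a) cat \<Rightarrow> ('o, 'a) cat \<Rightarrow> bool" where
  "full_subcategory D C \<longleftrightarrow>
     Obj D \<subseteq> Obj C \<and>
     (\<forall>X\<in>Obj D. \<forall>Y\<in>Obj D. Hom D X Y = Hom C X Y) \<and>
     (\<forall>X\<in>Obj D. Ident D X = Ident C X) \<and>
     (\<forall>X Y Z f g. arr D X Y f \<longrightarrow> arr D Y Z g \<longrightarrow> Cmp D X Y Z g f = Cmp C X Y Z g f)"

definition splits :: "('o, 'a) cat \<Rightarrow> 'o \<Rightarrow> 'o \<Rightarrow> 'a \<Rightarrow> bool" where
  "splits C X W q \<longleftrightarrow> (\<exists>s. arr C W X s \<and> Cmp C W X W q s = Ident C W)"

record ('o, 'a, 'p, 'b) fctr =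
  ob :: "'o \<Rightarrow> 'p"
  ar :: "'o \<Rightarrow> 'o \<Rightarrow> 'a \<Rightarrow> 'b"

locale cat_functor = C: category C + D: category D
  for C :: "('o, 'a) cat" and D :: "('p, 'b) cat" +
  fixes F :: "('o, 'a, 'p, 'b) fctr"
  assumes ob_closed: "X \<in> Obj C \<Longrightarrow> ob F X \<in> Obj D"
    and ar_closed: "arr C X Y f \<Longrightarrow> ar F X Y f \<in> Hom D (ob F X) (ob F Y)"
    and ar_ident: "X \<in> Obj C \<Longrightarrow> ar F X X (Ident C X) = Ident D (ob F X)"
    and ar_cmp: "arr C X Y f \<Longrightarrow> arr C Y Z g \<Longrightarrow>
      ar F X Z (Cmp C X Y Z g f) = Cmp D (ob F X) (ob F Y) (ob F Z) (ar F Y Z g) (ar F X Y f)"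

definition id_fctr :: "('o, 'a, 'o, 'a) fctr" where
  "id_fctr = \<lparr>ob = (\<lambda>X. X), ar = (\<lambda>X Y f. f)\<rparr>"

definition comp_fctr ::
  "('p, 'b, 'q, 'c) fctr \<Rightarrow> ('o, 'a, 'p, 'b) fctr \<Rightarrow> ('o, 'a, 'q, 'c) fctr" where
  "comp_fctr G F = \<lparr>ob = (\<lambda>X. ob G (ob F X)), ar = (\<lambda>X Y f. ar G (ob F X) (ob F Y) (ar F X Y f))\<rparr>"

locale natural_transformation = F: cat_functor C D F + G: cat_functor C D G
  for C :: "('o, 'a) cat" and D :: "('p, 'b) cat" and F G :: "('o, 'a, 'p, 'b) fctr" +
  fixes \<theta> :: "'o \<Rightarrow> 'b"
  assumes comp_closed: "X \<in> Obj C \<Longrightarrow> \<theta> X \<in> Hom D (ob F X) (ob G X)"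
    and naturality: "arr C X Y f \<Longrightarrow>
      Cmp D (ob F X) (ob F Y) (ob G Y) (\<theta> Y) (ar F X Y f) =
      Cmp D (ob F X) (ob G X) (ob G Y) (ar G X Y f) (\<theta> X)"

locale cat_monad =
  T: cat_functor C C T +
  \<eta>: natural_transformation C C id_fctr T \<eta> +
  \<mu>: natural_transformation C C "comp_fctr T T" T \<mu>
  for C :: "('o, 'a) cat" and T \<eta> \<mu> +
  assumes unit_left: "X \<in> Obj C \<Longrightarrow>
      Cmp C (ob T X) (ob T (ob T X)) (ob T X) (\<mu> X) (\<eta> (ob T X)) = Ident C (ob T X)"
    and unit_right: "X \<in> Obj C \<Longrightarrow>
      Cmp C (ob T X) (ob T (ob T X)) (ob T X) (\<mu> X) (ar T X (ob T X) (\<eta> X)) = Ident C (ob T X)"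
    and mult_assoc: "X \<in> Obj C \<Longrightarrow>
      Cmp C (ob T (ob T (ob T X))) (ob T (ob T X)) (ob T X)
        (\<mu> X) (ar T (ob T (ob T X)) (ob T X) (\<mu> X)) =
      Cmp C (ob T (ob T (ob T X))) (ob T (ob T X)) (ob T X) (\<mu> X) (\<mu> (ob T X))"

text \<open>
  \<open>Fib R X Y\<close> with \<open>Leq R X Y\<close> is the poset \<open>R(X,Y)\<close>.  For \<open>f : A \<rightarrow> X\<close> and \<open>g : B \<rightarrow> Y\<close>,
  \<open>Reindex R A X B Y f g\<close> is the map from \<open>R(X,Y)\<close> to \<open>R(A,B)\<close>.  Relational composition
  \<open>RComp R X Y Z \<alpha> \<beta>\<close> is in diagrammatic order, unlike \<^const>\<open>Cmp\<close>.
\<close>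

record ('o, 'a, 'r) doctrine =
  Base :: "('o, 'a) cat"
  Fib :: "'o \<Rightarrow> 'o \<Rightarrow> 'r set"
  Leq :: "'o \<Rightarrow> 'o \<Rightarrow> 'r \<Rightarrow> 'r \<Rightarrow> bool"
  Reindex :: "'o \<Rightarrow> 'o \<Rightarrow> 'o \<Rightarrow> 'o \<Rightarrow> 'a \<Rightarrow> 'a \<Rightarrow> 'r \<Rightarrow> 'r"
  RComp :: "'o \<Rightarrow> 'o \<Rightarrow> 'o \<Rightarrow> 'r \<Rightarrow> 'r \<Rightarrow> 'r"
  RId :: "'o \<Rightarrow> 'r"
  Conv :: "'o \<Rightarrow> 'o \<Rightarrow> 'r \<Rightarrow> 'r"

abbreviation rel :: "('o, 'a, 'r) doctrine \<Rightarrow> 'o \<Rightarrow> 'o \<Rightarrow> 'r \<Rightarrow> bool" where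
  "rel R X Y \<alpha> \<equiv> X \<in> Obj (Base R) \<and> Y \<in> Obj (Base R) \<and> \<alpha> \<in> Fib R X Y"

locale relational_doctrine = category "Base R" for R :: "('o, 'a, 'r) doctrine" +
  assumes leq_refl: "X \<in> Obj (Base R) \<Longrightarrow> Y \<in> Obj (Base R) \<Longrightarrow> reflp_on (Fib R X Y) (Leq R X Y)"
    and leq_trans: "X \<in> Obj (Base R) \<Longrightarrow> Y \<in> Obj (Base R) \<Longrightarrow> transp_on (Fib R X Y) (Leq R X Y)"
    and leq_antisym: "X \<in> Obj (Base R) \<Longrightarrow> Y \<in> Obj (Base R) \<Longrightarrow> antisymp_on (Fib R X Y) (Leq R X Y)"
    \<comment> \<open>functoriality of \<open>R\<close>\<close>
    and reindex_closed: "arr (Base R) A X f \<Longrightarrow> arr (Base R) B Y g \<Longrightarrow> \<alpha> \<in> Fib R X Y \<Longrightarrow>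
      Reindex R A X B Y f g \<alpha> \<in> Fib R A B"
    and reindex_mono: "arr (Base R) A X f \<Longrightarrow> arr (Base R) B Y g \<Longrightarrow>
      monotone_on (Fib R X Y) (Leq R X Y) (Leq R A B) (Reindex R A X B Y f g)"
    and reindex_ident: "rel R X Y \<alpha> \<Longrightarrow>
      Reindex R X X Y Y (Ident (Base R) X) (Ident (Base R) Y) \<alpha> = \<alpha>"
    and reindex_cmp: "arr (Base R) A' A f' \<Longrightarrow> arr (Base R) A X f \<Longrightarrow>
      arr (Base R) B' B g' \<Longrightarrow> arr (Base R) B Y g \<Longrightarrow> \<alpha> \<in> Fib R X Y \<Longrightarrow>
      Reindex R A' X B' Y (Cmp (Base R) A' A X f f') (Cmp (Base R) B' B Y g g') \<alpha> =
      Reindex R A' A B' B f' g' (Reindex R A X B Y f g \<alpha>)"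
    \<comment> \<open>relational operations\<close>
    and rcomp_closed: "rel R X Y \<alpha> \<Longrightarrow> rel R Y Z \<beta> \<Longrightarrow> RComp R X Y Z \<alpha> \<beta> \<in> Fib R X Z"
    and rcomp_mono: "rel R X Y \<alpha> \<Longrightarrow> rel R X Y \<alpha>' \<Longrightarrow> rel R Y Z \<beta> \<Longrightarrow> rel R Y Z \<beta>' \<Longrightarrow>
      Leq R X Y \<alpha> \<alpha>' \<Longrightarrow> Leq R Y Z \<beta> \<beta>' \<Longrightarrow>
      Leq R X Z (RComp R X Y Z \<alpha> \<beta>) (RComp R X Y Z \<alpha>' \<beta>')"
    and rid_closed: "X \<in> Obj (Base R) \<Longrightarrow> RId R X \<in> Fib R X X"
    and conv_closed: "rel R X Y \<alpha> \<Longrightarrow> Conv R X Y \<alpha> \<in> Fib R Y X"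
    and conv_mono: "X \<in> Obj (Base R) \<Longrightarrow> Y \<in> Obj (Base R) \<Longrightarrow>
      monotone_on (Fib R X Y) (Leq R X Y) (Leq R Y X) (Conv R X Y)"
    and rcomp_assoc: "rel R X Y \<alpha> \<Longrightarrow> rel R Y Z \<beta> \<Longrightarrow> rel R Z W \<gamma> \<Longrightarrow>
      RComp R X Y W \<alpha> (RComp R Y Z W \<beta> \<gamma>) = RComp R X Z W (RComp R X Y Z \<alpha> \<beta>) \<gamma>"
    and rid_left: "rel R X Y \<alpha> \<Longrightarrow> RComp R X X Y (RId R X) \<alpha> = \<alpha>"
    and rid_right: "rel R X Y \<alpha> \<Longrightarrow> RComp R X Y Y \<alpha> (RId R Y) = \<alpha>"
    and conv_rcomp: "rel R X Y \<alpha> \<Longrightarrow> rel R Y Z \<beta> \<Longrightarrow>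
      Conv R X Z (RComp R X Y Z \<alpha> \<beta>) = RComp R Z Y X (Conv R Y Z \<beta>) (Conv R X Y \<alpha>)"
    and conv_rid: "X \<in> Obj (Base R) \<Longrightarrow> Conv R X X (RId R X) = RId R X"
    and conv_conv: "rel R X Y \<alpha> \<Longrightarrow> Conv R Y X (Conv R X Y \<alpha>) = \<alpha>"
    \<comment> \<open>lax naturality of the relational operations\<close>
    and reindex_rcomp: "arr (Base R) A X f \<Longrightarrow> arr (Base R) B Y g \<Longrightarrow> arr (Base R) D Z h \<Longrightarrow>
      \<alpha> \<in> Fib R X Y \<Longrightarrow> \<beta> \<in> Fib R Y Z \<Longrightarrow>
      Leq R A D (RComp R A B D (Reindex R A X B Y f g \<alpha>) (Reindex R B Y D Z g h \<beta>))
        (Reindex R A X D Z f h (RComp R X Y Z \<alpha> \<beta>))"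
    and reindex_rid: "arr (Base R) A X f \<Longrightarrow> Leq R A A (RId R A) (Reindex R A X A X f f (RId R X))"
    and reindex_conv: "arr (Base R) A X f \<Longrightarrow> arr (Base R) B Y g \<Longrightarrow> \<alpha> \<in> Fib R X Y \<Longrightarrow>
      Leq R B A (Conv R A B (Reindex R A X B Y f g \<alpha>)) (Reindex R B Y A X g f (Conv R X Y \<alpha>))"

definition graph :: "('o, 'a, 'r) doctrine \<Rightarrow> 'o \<Rightarrow> 'o \<Rightarrow> 'a \<Rightarrow> 'r" where
  "graph R X Y f = Reindex R X Y Y Y f (Ident (Base R) Y) (RId R Y)"

definition extensional :: "('o, 'a, 'r) doctrine \<Rightarrow> bool" where
  "extensional R \<longleftrightarrow> (\<forall>X Y f g. arr (Base R) X Y f \<longrightarrow> arr (Base R) X Y g \<longrightarrow>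
     graph R X Y f = graph R X Y g \<longrightarrow> f = g)"

definition equivalence :: "('o, 'a, 'r) doctrine \<Rightarrow> 'o \<Rightarrow> 'r \<Rightarrow> bool" where
  "equivalence R X \<rho> \<longleftrightarrow> rel R X X \<rho> \<and>
     Leq R X X (RId R X) \<rho> \<and> Leq R X X (Conv R X X \<rho>) \<rho> \<and> Leq R X X (RComp R X X X \<rho> \<rho>) \<rho>"

text \<open>\<open>\<Gamma>\<^sub>f ; \<Gamma>\<^sub>f\<^sup>\<bottom>\<close> in \<open>R(X,X)\<close>, for \<open>f : X \<rightarrow> Y\<close>\<close>

definition ker :: "('o, 'a, 'r) doctrine \<Rightarrow> 'o \<Rightarrow> 'o \<Rightarrow> 'a \<Rightarrow> 'r" where
  "ker R X Y f = RComp R X Y X (graph R X Y f) (Conv R X Y (graph R X Y f))"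

definition quotient_arrow_of ::
  "('o, 'a, 'r) doctrine \<Rightarrow> 'o \<Rightarrow> 'r \<Rightarrow> 'o \<Rightarrow> 'a \<Rightarrow> bool" where
  "quotient_arrow_of R X \<rho> W q \<longleftrightarrow>
     arr (Base R) X W q \<and> Leq R X X \<rho> (ker R X W q) \<and>
     (\<forall>Z f. arr (Base R) X Z f \<and> Leq R X X \<rho> (ker R X Z f) \<longrightarrow>
        (\<exists>!h. arr (Base R) W Z h \<and> f = Cmp (Base R) X W Z h q))"

definition effective :: "('o, 'a, 'r) doctrine \<Rightarrow> 'o \<Rightarrow> 'r \<Rightarrow> 'o \<Rightarrow> 'a \<Rightarrow> bool" where
  "effective R X \<rho> W q \<longleftrightarrow> \<rho> = ker R X W q"

definition descent :: "('o, 'a, 'r) doctrine \<Rightarrow> 'o \<Rightarrow> 'o \<Rightarrow> 'a \<Rightarrow> bool" where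
  "descent R X W q \<longleftrightarrow>
     RComp R W X W (Conv R X W (graph R X W q)) (graph R X W q) = RId R W"

definition quotient_arrow :: "('o, 'a, 'r) doctrine \<Rightarrow> 'o \<Rightarrow> 'o \<Rightarrow> 'a \<Rightarrow> bool" where
  "quotient_arrow R X W q \<longleftrightarrow> (\<exists>\<rho>. equivalence R X \<rho> \<and> quotient_arrow_of R X \<rho> W q)"

definition has_quotients :: "('o, 'a, 'r) doctrine \<Rightarrow> bool" where
  "has_quotients R \<longleftrightarrow> (\<forall>X \<rho>. equivalence R X \<rho> \<longrightarrow>
     (\<exists>W q. quotient_arrow_of R X \<rho> W q \<and> effective R X \<rho> W q \<and> descent R X W q))"

definition projective :: "('o, 'a, 'r) doctrine \<Rightarrow> 'o \<Rightarrow> bool" where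
  "projective R P \<longleftrightarrow> P \<in> Obj (Base R) \<and>
     (\<forall>X Y f q. arr (Base R) P Y f \<and> quotient_arrow R X Y q \<longrightarrow>
        (\<exists>h. arr (Base R) P X h \<and> f = Cmp (Base R) P X Y q h))"

definition projective_cover :: "('o, 'a, 'r) doctrine \<Rightarrow> ('o, 'a) cat \<Rightarrow> bool" where
  "projective_cover R D \<longleftrightarrow> full_subcategory D (Base R) \<and>
     (\<forall>P\<in>Obj D. projective R P) \<and>
     (\<forall>X\<in>Obj (Base R). \<exists>P\<in>Obj D. \<exists>q. quotient_arrow R P X q)"

text \<open>The 2-category of relational doctrines: \<open>Hat\<close> and \<open>Bar\<close> are the two components of a 1-arrow.\<close>

record ('o, 'a, 'r, 'p, 'b, 's) doctrine_map =
  Hat :: "('o, 'a, 'p, 'b) fctr"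
  Bar :: "'o \<Rightarrow> 'o \<Rightarrow> 'r \<Rightarrow> 's"

locale one_arrow =
  R: relational_doctrine R + S: relational_doctrine S +
  Hat: cat_functor "Base R" "Base S" "Hat F"
  for R :: "('o, 'a, 'r) doctrine" and S :: "('p, 'b, 's) doctrine"
    and F :: "('o, 'a, 'r, 'p, 'b, 's) doctrine_map" +
  assumes bar_closed: "rel R X Y \<alpha> \<Longrightarrow> Bar F X Y \<alpha> \<in> Fib S (ob (Hat F) X) (ob (Hat F) Y)"
    and bar_mono: "X \<in> Obj (Base R) \<Longrightarrow> Y \<in> Obj (Base R) \<Longrightarrow>
      monotone_on (Fib R X Y) (Leq R X Y) (Leq S (ob (Hat F) X) (ob (Hat F) Y)) (Bar F X Y)"
    and bar_natural: "arr (Base R) A X f \<Longrightarrow> arr (Base R) B Y g \<Longrightarrow> \<alpha> \<in> Fib R X Y \<Longrightarrow>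
      Bar F A B (Reindex R A X B Y f g \<alpha>) =
      Reindex S (ob (Hat F) A) (ob (Hat F) X) (ob (Hat F) B) (ob (Hat F) Y)
        (ar (Hat F) A X f) (ar (Hat F) B Y g) (Bar F X Y \<alpha>)"
    and bar_rid: "X \<in> Obj (Base R) \<Longrightarrow> Bar F X X (RId R X) = RId S (ob (Hat F) X)"
    and bar_rcomp: "rel R X Y \<alpha> \<Longrightarrow> rel R Y Z \<beta> \<Longrightarrow>
      Bar F X Z (RComp R X Y Z \<alpha> \<beta>) =
      RComp S (ob (Hat F) X) (ob (Hat F) Y) (ob (Hat F) Z) (Bar F X Y \<alpha>) (Bar F Y Z \<beta>)"
    and bar_conv: "rel R X Y \<alpha> \<Longrightarrow>
      Bar F Y X (Conv R X Y \<alpha>) = Conv S (ob (Hat F) X) (ob (Hat F) Y) (Bar F X Y \<alpha>)"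

definition id_map :: "('o, 'a, 'r, 'o, 'a, 'r) doctrine_map" where
  "id_map = \<lparr>Hat = id_fctr, Bar = (\<lambda>X Y \<alpha>. \<alpha>)\<rparr>"

definition comp_map ::
  "('p, 'b, 's, 'q, 'c, 't) doctrine_map \<Rightarrow> ('o, 'a, 'r, 'p, 'b, 's) doctrine_map \<Rightarrow>
   ('o, 'a, 'r, 'q, 'c, 't) doctrine_map" where
  "comp_map G F = \<lparr>Hat = comp_fctr (Hat G) (Hat F),
     Bar = (\<lambda>X Y \<alpha>. Bar G (ob (Hat F) X) (ob (Hat F) Y) (Bar F X Y \<alpha>))\<rparr>"

locale two_arrow =
  F: one_arrow R S F + G: one_arrow R S G +
  natural_transformation "Base R" "Base S" "Hat F" "Hat G" \<theta>
  for R :: "('o, 'a, 'r) doctrine" and S :: "('p, 'b, 's) doctrine"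
    and F G :: "('o, 'a, 'r, 'p, 'b, 's) doctrine_map" and \<theta> :: "'o \<Rightarrow> 'b" +
  assumes bar_leq: "rel R X Y \<alpha> \<Longrightarrow>
    Leq S (ob (Hat F) X) (ob (Hat F) Y) (Bar F X Y \<alpha>)
      (Reindex S (ob (Hat F) X) (ob (Hat G) X) (ob (Hat F) Y) (ob (Hat G) Y)
        (\<theta> X) (\<theta> Y) (Bar G X Y \<alpha>))"

locale doctrine_monad =
  T: one_arrow R R T +
  \<eta>: two_arrow R R id_map T \<eta> +
  \<mu>: two_arrow R R "comp_map T T" T \<mu> +
  Hat: cat_monad "Base R" "Hat T" \<eta> \<mu>
  for R :: "('o, 'a, 'r) doctrine" and T :: "('o, 'a, 'r, 'o, 'a, 'r) doctrine_map"
    and \<eta> \<mu> :: "'o \<Rightarrow> 'a"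

definition em_category ::
  "('o, 'a) cat \<Rightarrow> ('o, 'a, 'o, 'a) fctr \<Rightarrow> ('o \<Rightarrow> 'a) \<Rightarrow> ('o \<Rightarrow> 'a) \<Rightarrow> ('o \<times> 'a, 'a) cat" where
  "em_category C T \<eta> \<mu> = \<lparr>
     Obj = {(X, a). arr C (ob T X) X a \<and> X \<in> Obj C \<and>
       Cmp C X (ob T X) X a (\<eta> X) = Ident C X \<and>
       Cmp C (ob T (ob T X)) (ob T X) X a (ar T (ob T X) X a) =
       Cmp C (ob T (ob T X)) (ob T X) X a (\<mu> X)},
     Hom = (\<lambda>(X, a) (Y, b). {f \<in> Hom C X Y.
       Cmp C (ob T X) X Y f a = Cmp C (ob T X) (ob T Y) Y b (ar T X Y f)}),
     Ident = (\<lambda>(X, a). Ident C X),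
     Cmp = (\<lambda>(X, a) (Y, b) (Z, c). Cmp C X Y Z)\<rparr>"

definition free_algebras ::
  "('o, 'a) cat \<Rightarrow> ('o, 'a, 'o, 'a) fctr \<Rightarrow> ('o \<Rightarrow> 'a) \<Rightarrow> ('o \<Rightarrow> 'a) \<Rightarrow> ('o \<times> 'a, 'a) cat" where
  "free_algebras C T \<eta> \<mu> = (em_category C T \<eta> \<mu>)\<lparr>Obj := {(ob T X, \<mu> X) | X. X \<in> Obj C}\<rparr>"

definition em_doctrine ::
  "('o, 'a, 'r) doctrine \<Rightarrow> ('o, 'a, 'r, 'o, 'a, 'r) doctrine_map \<Rightarrow>
   ('o \<Rightarrow> 'a) \<Rightarrow> ('o \<Rightarrow> 'a) \<Rightarrow> ('o \<times> 'a, 'a, 'r) doctrine" where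
  "em_doctrine R T \<eta> \<mu> = \<lparr>
     Base = em_category (Base R) (Hat T) \<eta> \<mu>,
     Fib = (\<lambda>(X, a) (Y, b). let TX = ob (Hat T) X; TY = ob (Hat T) Y in
       {\<alpha> \<in> Fib R X Y. Leq R X Y
          (RComp R X TY Y
            (RComp R X TX TY (Conv R TX X (graph R TX X a)) (Bar T X Y \<alpha>))
            (graph R TY Y b))
          \<alpha>}),
     Leq = (\<lambda>(X, a) (Y, b). Leq R X Y),
     Reindex = (\<lambda>(A, c) (X, a) (B, d) (Y, b). Reindex R A X B Y),
     RComp = (\<lambda>(X, a) (Y, b) (Z, c). RComp R X Y Z),
     RId = (\<lambda>(X, a). RId R X),
     Conv = (\<lambda>(X, a) (Y, b). Conv R X Y)\<rparr>"

text \<open>The Eilenberg--Moore construction does yield a relational doctrine.\<close>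

lemma category_em_category:
  assumes "cat_monad C T \<eta> \<mu>"
  shows "category (em_category C T \<eta> \<mu>)"
proof -
  interpret cat_monad C T \<eta> \<mu> by fact
  let ?E = "em_category C T \<eta> \<mu>"
  have E: "arr ?E (X, a) (Y, b) f \<Longrightarrow> arr C X Y f \<and> arr C (ob T X) X a \<and> arr C (ob T Y) Y b \<and>
      Cmp C (ob T X) X Y f a = Cmp C (ob T X) (ob T Y) Y b (ar T X Y f)" for X a Y b f
    by (auto simp: em_category_def)
  show ?thesis
  proof
    fix x assume "x \<in> Obj ?E"
    then show "Ident ?E x \<in> Hom ?E x x"
      by (cases x) (auto simp: em_category_def T.C.ident_arr T.ar_ident T.C.cmp_ident_left T.C.cmp_ident_right)
  next
    fix x y z f g assume f: "arr ?E x y f" and g: "arr ?E y z g"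
    obtain X a Y b Z c where xyz: "x = (X, a)" "y = (Y, b)" "z = (Z, c)" by (cases x, cases y, cases z)
    note f = E[OF f[unfolded xyz]] and g = E[OF g[unfolded xyz]]
    have "Cmp C (ob T X) X Z (Cmp C X Y Z g f) a = Cmp C (ob T X) Y Z g (Cmp C (ob T X) X Y f a)"
      using f g by (simp add: T.C.cmp_assoc)
    also have "\<dots> = Cmp C (ob T X) (ob T Y) Z (Cmp C (ob T Y) Y Z g b) (ar T X Y f)"
      using f g T.C.cmp_assoc[of "ob T X" "ob T Y" "ar T X Y f" Y b Z g] by (simp add: T.ar_closed)
    also have "\<dots> = Cmp C (ob T X) (ob T Z) Z c (ar T X Z (Cmp C X Y Z g f))"
      using f g by (simp add: T.C.cmp_assoc T.ar_closed T.ar_cmp)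
    finally show "Cmp ?E x y z g f \<in> Hom ?E x z"
      using f g by (simp add: em_category_def xyz T.C.cmp_arr)
  qed (auto simp: em_category_def T.C.cmp_ident_left T.C.cmp_ident_right T.C.cmp_assoc)
qed

lemma relational_doctrine_em_doctrine:
  assumes "doctrine_monad R T \<eta> \<mu>"
  shows "relational_doctrine (em_doctrine R T \<eta> \<mu>)"
proof -
  interpret doctrine_monad R T \<eta> \<mu> by fact
  let ?E = "em_doctrine R T \<eta> \<mu>" and ?C = "Base R"
  let ?T = "\<lambda>X. ob (Hat T) X"
  define act where "act X a Y b \<alpha> = RComp R X (?T Y) Y
    (RComp R X (?T X) (?T Y) (Conv R (?T X) X (graph R (?T X) X a)) (Bar T X Y \<alpha>))
    (graph R (?T Y) Y b)" for X a Y b \<alpha>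
  have obj: "(X, a) \<in> Obj (Base ?E) \<Longrightarrow>
      arr ?C (?T X) X a \<and> Cmp ?C X (?T X) X a (\<eta> X) = Ident ?C X" for X a
    by (auto simp: em_doctrine_def em_category_def)
  have hom: "arr (Base ?E) (X, a) (Y, b) f \<Longrightarrow> arr ?C X Y f \<and>
      arr ?C (?T X) X a \<and> arr ?C (?T Y) Y b \<and>
      Cmp ?C (?T X) X Y f a = Cmp ?C (?T X) (?T Y) Y b (ar (Hat T) X Y f)" for X a Y b f
    by (auto simp: em_doctrine_def em_category_def)
  have fib: "\<alpha> \<in> Fib ?E (X, a) (Y, b) \<longleftrightarrow> \<alpha> \<in> Fib R X Y \<and> Leq R X Y (act X a Y b \<alpha>) \<alpha>"
    for X a Y b \<alpha> by (simp add: em_doctrine_def act_def Let_def)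
  have ops: "Leq ?E (X, a) (Y, b) = Leq R X Y" "Reindex ?E (A, c) (X, a) (B, d) (Y, b) = Reindex R A X B Y"
    "RComp ?E (X, a) (Y, b) (Z, e) = RComp R X Y Z" "RId ?E (X, a) = RId R X"
    "Conv ?E (X, a) (Y, b) = Conv R X Y" "Ident (Base ?E) (X, a) = Ident ?C X"
    "Cmp (Base ?E) (X, a) (Y, b) (Z, e) = Cmp ?C X Y Z" for X a Y b A c B d Z e
    by (simp_all add: em_doctrine_def em_category_def)
  note D = T.R.ident_arr T.R.cmp_arr T.R.reindex_closed T.R.rcomp_closed T.R.rid_closed
    T.R.conv_closed T.bar_closed T.Hat.ob_closed T.Hat.ar_closed
  have refl: "rel R X Y \<alpha> \<Longrightarrow> Leq R X Y \<alpha> \<alpha>" for X Y \<alpha>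
    by (intro reflp_onD[OF T.R.leq_refl]) auto
  have trans: "rel R X Y \<alpha> \<Longrightarrow> rel R X Y \<beta> \<Longrightarrow> rel R X Y \<gamma> \<Longrightarrow>
      Leq R X Y \<alpha> \<beta> \<Longrightarrow> Leq R X Y \<beta> \<gamma> \<Longrightarrow> Leq R X Y \<alpha> \<gamma>" for X Y \<alpha> \<beta> \<gamma>
    by (rule transp_onD[OF T.R.leq_trans, of X Y]) auto
  have graph: "arr ?C X Y f \<Longrightarrow> graph R X Y f \<in> Fib R X Y" for X Y f
    by (simp add: graph_def D)
  have act_closed: "arr ?C (?T X) X a \<Longrightarrow> arr ?C (?T Y) Y b \<Longrightarrow> \<alpha> \<in> Fib R X Y \<Longrightarrow>
      act X a Y b \<alpha> \<in> Fib R X Y" for X a Y b \<alpha>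
    by (simp add: act_def D graph)
  have single_valued: "Leq R Y Y (RComp R Y X Y (Conv R X Y (graph R X Y f)) (graph R X Y f)) (RId R Y)"
    if f: "arr ?C X Y f" for X Y f
  proof -
    let ?i = "Ident ?C Y" and ?d = "RId R Y"
    have c: "Leq R Y X (Conv R X Y (graph R X Y f)) (Reindex R Y Y X Y ?i f ?d)"
      using T.R.reindex_conv[of X Y f Y Y ?i ?d] f by (simp add: graph_def D T.R.conv_rid)
    have "Leq R Y Y (RComp R Y X Y (Reindex R Y Y X Y ?i f ?d) (graph R X Y f)) ?d"
      using T.R.reindex_rcomp[of Y Y ?i X Y f Y Y ?i ?d ?d] f
      by (simp add: graph_def D T.R.rid_left T.R.reindex_ident)
    moreover have "Leq R Y Y (RComp R Y X Y (Conv R X Y (graph R X Y f)) (graph R X Y f))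
        (RComp R Y X Y (Reindex R Y Y X Y ?i f ?d) (graph R X Y f))"
      using f c by - (rule T.R.rcomp_mono, auto simp: D graph refl)
    ultimately show ?thesis using f 
      by - (rule trans[of Y Y _
        "RComp R Y X Y (Reindex R Y Y X Y ?i f ?d) (graph R X Y f)" ?d], auto simp: D graph)
  qed
  have conv_reindex: "Conv R A B (Reindex R A X B Y f g \<alpha>) = Reindex R B Y A X g f (Conv R X Y \<alpha>)"
    if f: "arr ?C A X f" and g: "arr ?C B Y g" and \<alpha>: "\<alpha> \<in> Fib R X Y" for A X B Y f g \<alpha>
  proof -
    have 1: "Leq R A B (Conv R B A (Reindex R B Y A X g f (Conv R X Y \<alpha>))) (Reindex R A X B Y f g \<alpha>)"
      using T.R.reindex_conv[of B Y g A X f "Conv R X Y \<alpha>"] f g \<alpha> by (simp add: D T.R.conv_conv)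
    have "Leq R B A (Conv R A B (Conv R B A (Reindex R B Y A X g f (Conv R X Y \<alpha>))))
        (Conv R A B (Reindex R A X B Y f g \<alpha>))"
      using f g \<alpha> 1 by - (rule monotone_onD[OF T.R.conv_mono], auto simp: D)
    then have "Leq R B A (Reindex R B Y A X g f (Conv R X Y \<alpha>)) (Conv R A B (Reindex R A X B Y f g \<alpha>))"
      using f g \<alpha> by (simp add: D T.R.conv_conv)
    then show ?thesis
      using T.R.reindex_conv[OF f g \<alpha>] f g \<alpha>
      by - (rule antisymp_onD[OF T.R.leq_antisym[of B A]], auto simp: D)
  qed
  have total: "Leq R X X (RId R X) (RComp R X Y X (graph R X Y f) (Conv R X Y (graph R X Y f)))"
    if f: "arr ?C X Y f" for X Y f
  proof -
    let ?i = "Ident ?C X" and ?j = "Ident ?C Y" and ?d = "RId R Y"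
    have 1: "Reindex R X X X Y ?i f (graph R X Y f) = Reindex R X Y X Y f f ?d"
      using T.R.reindex_cmp[of X X ?i Y f X Y f Y ?j ?d] f
      by (simp add: graph_def D T.R.cmp_ident_left T.R.cmp_ident_right)
    have 2: "Reindex R X Y X X f ?i (Conv R X Y (graph R X Y f)) = Reindex R X Y X Y f f ?d"
      using conv_reindex[of X X ?i X Y f "graph R X Y f"] conv_reindex[of X Y f X Y f ?d] f 1
      by (simp add: D graph T.R.conv_rid)
    let ?r = "Reindex R X Y X Y f f ?d"
    have "Leq R X X (RComp R X X X ?r ?r) (RComp R X Y X (graph R X Y f) (Conv R X Y (graph R X Y f)))"
      using T.R.reindex_rcomp[of X X ?i X Y f X X ?i "graph R X Y f" "Conv R X Y (graph R X Y f)"] f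
      by (simp add: D graph 1 2 T.R.reindex_ident)
    moreover have "Leq R X X (RComp R X X X (RId R X) (RId R X)) (RComp R X X X ?r ?r)"
      using f T.R.reindex_rid[of X Y f] by - (rule T.R.rcomp_mono, auto simp: D)
    ultimately show ?thesis
      using f by - (rule trans[of X X _ "RComp R X X X ?r ?r"], auto simp: D graph T.R.rid_left)
  qed
  have graph_hom: "Leq R (?T A) A (graph R (?T A) A c)
      (Reindex R (?T A) (?T X) A X (ar (Hat T) A X f) f (graph R (?T X) X a))"
    if "arr (Base ?E) (A, c) (X, a) f" for A c X a f
  proof -
    note h = hom[OF that]
    have Tf: "ar (Hat T) A X f \<in> Hom ?C (?T A) (?T X)" using h by (simp add: D)
    have "Reindex R (?T A) A A A c (Ident ?C A) (Reindex R A X A X f f (RId R X)) =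
        Reindex R (?T A) X A X (Cmp ?C (?T A) A X f c) f (RId R X)"
      using h T.R.reindex_cmp[of "?T A" A c X f A A "Ident ?C A" X f "RId R X"]
      by (simp add: D T.R.cmp_ident_right)
    also have "\<dots> = Reindex R (?T A) (?T X) A X (ar (Hat T) A X f) f (graph R (?T X) X a)"
      using h Tf T.R.reindex_cmp[of "?T A" "?T X" "ar (Hat T) A X f" X a A X f X "Ident ?C X" "RId R X"]
      by (simp add: graph_def D T.R.cmp_ident_left)
    finally have eq: "Reindex R (?T A) A A A c (Ident ?C A) (Reindex R A X A X f f (RId R X)) = \<dots>" .
    have "Leq R (?T A) A (graph R (?T A) A c)
        (Reindex R (?T A) A A A c (Ident ?C A) (Reindex R A X A X f f (RId R X)))"
      unfolding graph_def
      using h by - (rule monotone_onD[OF T.R.reindex_mono], auto simp: D T.R.reindex_rid)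
    then show ?thesis by (simp add: eq)
  qed
  have reindex: "Reindex R A X B Y f g \<alpha> \<in> Fib ?E (A, c) (B, d)"
    if f: "arr (Base ?E) (A, c) (X, a) f" and g: "arr (Base ?E) (B, d) (Y, b) g"
      and \<alpha>: "\<alpha> \<in> Fib ?E (X, a) (Y, b)" for A c X a f B d Y b g \<alpha>
  proof -
    note hf = hom[OF f] and hg = hom[OF g]
    have \<alpha>': "\<alpha> \<in> Fib R X Y" "Leq R X Y (act X a Y b \<alpha>) \<alpha>" using \<alpha> by (simp_all add: fib)
    let ?Tf = "ar (Hat T) A X f" and ?Tg = "ar (Hat T) B Y g"
    have T: "?Tf \<in> Hom ?C (?T A) (?T X)" "?Tg \<in> Hom ?C (?T B) (?T Y)" using hf hg by (simp_all add: D)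
    let ?Ga = "graph R (?T X) X a" and ?Gb = "graph R (?T Y) Y b"
    let ?p = "Reindex R A X (?T A) (?T X) f ?Tf (Conv R (?T X) X ?Ga)"
    let ?m = "Reindex R (?T A) (?T X) (?T B) (?T Y) ?Tf ?Tg (Bar T X Y \<alpha>)"
    let ?s = "Reindex R (?T B) (?T Y) B Y ?Tg g ?Gb"
    have 1: "Leq R A (?T A) (Conv R (?T A) A (graph R (?T A) A c)) ?p"
    proof -
      have "Leq R A (?T A) (Conv R (?T A) A (graph R (?T A) A c))
        (Conv R (?T A) A (Reindex R (?T A) (?T X) A X ?Tf f ?Ga))"
        using hf T graph_hom[OF f] by - (rule monotone_onD[OF T.R.conv_mono], auto simp: D graph)
      then show ?thesis using hf T by (simp add: conv_reindex graph)
    qed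
    have 2: "Leq R A (?T B) (RComp R A (?T A) (?T B) (Conv R (?T A) A (graph R (?T A) A c)) ?m)
        (RComp R A (?T A) (?T B) ?p ?m)"
      using hf hg T \<alpha>' 1 by - (rule T.R.rcomp_mono, auto simp: D graph refl)
    have 3: "Leq R A B (act A c B d (Reindex R A X B Y f g \<alpha>))
        (RComp R A (?T B) B (RComp R A (?T A) (?T B) ?p ?m) ?s)"
      unfolding act_def using hf hg T \<alpha>' 2 graph_hom[OF g]
      by (subst T.bar_natural) (auto intro!: T.R.rcomp_mono simp: D graph)
    have 4: "Leq R A (?T B) (RComp R A (?T A) (?T B) ?p ?m)
        (Reindex R A X (?T B) (?T Y) f ?Tg (RComp R X (?T X) (?T Y) (Conv R (?T X) X ?Ga) (Bar T X Y \<alpha>)))"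
      using hf hg T \<alpha>' by - (rule T.R.reindex_rcomp, auto simp: D graph)
    have 5: "Leq R A B (RComp R A (?T B) B (RComp R A (?T A) (?T B) ?p ?m) ?s) (RComp R A (?T B) B
        (Reindex R A X (?T B) (?T Y) f ?Tg (RComp R X (?T X) (?T Y) (Conv R (?T X) X ?Ga) (Bar T X Y \<alpha>))) ?s)"
      using hf hg T \<alpha>' 4 by - (rule T.R.rcomp_mono, auto simp: D graph refl)
    have 6: "Leq R A B (RComp R A (?T B) B
        (Reindex R A X (?T B) (?T Y) f ?Tg (RComp R X (?T X) (?T Y) (Conv R (?T X) X ?Ga) (Bar T X Y \<alpha>))) ?s)
        (Reindex R A X B Y f g (act X a Y b \<alpha>))"
      unfolding act_def using hf hg T \<alpha>' by - (rule T.R.reindex_rcomp, auto simp: D graph)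
    have 7: "Leq R A B (Reindex R A X B Y f g (act X a Y b \<alpha>)) (Reindex R A X B Y f g \<alpha>)"
      using hf hg \<alpha>' by - (rule monotone_onD[OF T.R.reindex_mono], auto simp: D act_closed)
    have "Leq R A B (act A c B d (Reindex R A X B Y f g \<alpha>)) (Reindex R A X B Y f g \<alpha>)"
      by (rule trans[OF _ _ _ 3 trans[OF _ _ _ 5 trans[OF _ _ _ 6 7]]])
        (use hf hg T \<alpha>' in \<open>auto simp: D graph act_closed\<close>)
    then show ?thesis using hf hg \<alpha>' by (simp add: fib D)
  qed
  have rid: "RId R X \<in> Fib ?E (X, a) (X, a)" if "(X, a) \<in> Obj (Base ?E)" for X a
    using obj[OF that] single_valued[of "?T X" X a]
    by (simp add: fib D act_def T.bar_rid T.R.rid_right graph)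
  have conv: "Conv R X Y \<alpha> \<in> Fib ?E (Y, b) (X, a)"
    if "(X, a) \<in> Obj (Base ?E)" "(Y, b) \<in> Obj (Base ?E)" "\<alpha> \<in> Fib ?E (X, a) (Y, b)" for X a Y b \<alpha>
  proof -
    note h = obj[OF that(1)] obj[OF that(2)] that(3)[unfolded fib]
    have "act Y b X a (Conv R X Y \<alpha>) = Conv R X Y (act X a Y b \<alpha>)"
      using h by (simp add: act_def T.bar_conv T.R.conv_rcomp T.R.conv_conv T.R.rcomp_assoc D graph)
    moreover have "Leq R Y X (Conv R X Y (act X a Y b \<alpha>)) (Conv R X Y \<alpha>)"
      using h by - (rule monotone_onD[OF T.R.conv_mono], auto simp: D act_closed)
    ultimately show ?thesis using h by (simp add: fib D)
  qed
  have rcomp: "RComp R X Y Z \<alpha> \<beta> \<in> Fib ?E (X, a) (Z, e)"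
    if "(X, a) \<in> Obj (Base ?E)" "(Y, b) \<in> Obj (Base ?E)" "(Z, e) \<in> Obj (Base ?E)"
      "\<alpha> \<in> Fib ?E (X, a) (Y, b)" "\<beta> \<in> Fib ?E (Y, b) (Z, e)" for X a Y b Z e \<alpha> \<beta>
  proof -
    note h = obj[OF that(1)] obj[OF that(2)] obj[OF that(3)] that(4,5)[unfolded fib]
    let ?Ga = "Conv R (?T X) X (graph R (?T X) X a)" and ?Ge = "graph R (?T Z) Z e"
    let ?Gb = "graph R (?T Y) Y b"
    let ?l = "RComp R X (?T X) (?T Y) ?Ga (Bar T X Y \<alpha>)" and ?r = "RComp R (?T Y) (?T Z) Z (Bar T Y Z \<beta>) ?Ge"
    let ?k = "RComp R (?T Y) Y (?T Y) ?Gb (Conv R (?T Y) Y ?Gb)"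
    have eq1: "act X a Z e (RComp R X Y Z \<alpha> \<beta>) = RComp R X (?T Y) Z ?l (RComp R (?T Y) (?T Y) Z (RId R (?T Y)) ?r)"
      using h by (simp add: act_def T.bar_rcomp T.R.rcomp_assoc T.R.rid_left D graph)
    have eq2: "RComp R X (?T Y) Z ?l (RComp R (?T Y) (?T Y) Z ?k ?r) =
        RComp R X Y Z (act X a Y b \<alpha>) (act Y b Z e \<beta>)"
      using h by (simp add: act_def T.R.rcomp_assoc D graph)
    have "Leq R (?T Y) Z (RComp R (?T Y) (?T Y) Z (RId R (?T Y)) ?r) (RComp R (?T Y) (?T Y) Z ?k ?r)"
      using h total by - (rule T.R.rcomp_mono, auto simp: D graph refl)
    then have 1: "Leq R X Z (act X a Z e (RComp R X Y Z \<alpha> \<beta>))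
        (RComp R X Y Z (act X a Y b \<alpha>) (act Y b Z e \<beta>))"
      unfolding eq1 eq2[symmetric] using h by - (rule T.R.rcomp_mono, auto simp: D graph refl)
    have 2: "Leq R X Z (RComp R X Y Z (act X a Y b \<alpha>) (act Y b Z e \<beta>)) (RComp R X Y Z \<alpha> \<beta>)"
      using h by - (rule T.R.rcomp_mono, auto simp: D act_closed)
    have "Leq R X Z (act X a Z e (RComp R X Y Z \<alpha> \<beta>)) (RComp R X Y Z \<alpha> \<beta>)"
      using h by - (rule trans[OF _ _ _ 1 2], auto simp: D act_closed)
    then show ?thesis using h by (simp add: fib D)
  qed
  have objD: "X \<in> Obj ?C" if "(X, a) \<in> Obj (Base ?E)" for X a
    using obj[OF that] by simp
  have homD: "f \<in> Hom ?C X Y" if "f \<in> Hom (Base ?E) (X, a) (Y, b)" for X a Y b f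
    using that by (simp add: em_doctrine_def em_category_def)
  have fibD: "\<alpha> \<in> Fib R X Y" if "\<alpha> \<in> Fib ?E (X, a) (Y, b)" for X a Y b \<alpha>
    using that by (simp add: fib)
  have sub: "Fib ?E (X, a) (Y, b) \<subseteq> Fib R X Y" for X a Y b
    using fibD by blast
  have "category (Base ?E)"
    using category_em_category[OF Hat.cat_monad_axioms] by (simp add: em_doctrine_def)
  then show ?thesis
    apply (rule relational_doctrine.intro)
    apply (rule relational_doctrine_axioms.intro)
    apply (simp_all only: split_paired_all ops)
    subgoal by (rule reflp_on_subset[OF T.R.leq_refl sub]) (auto dest: objD)
    subgoal by (rule transp_on_subset[OF T.R.leq_trans sub]) (auto dest: objD)
    subgoal by (rule antisymp_on_subset[OF T.R.leq_antisym sub]) (auto dest: objD)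
    subgoal by (rule reindex) auto
    subgoal by (rule monotone_on_subset[OF T.R.reindex_mono sub]) (auto dest: objD homD)
    subgoal by (rule T.R.reindex_ident) (auto dest: objD fibD)
    subgoal by (rule T.R.reindex_cmp) (auto dest: objD homD fibD)
    subgoal by (rule rcomp) auto
    subgoal by (rule T.R.rcomp_mono) (auto dest: objD fibD)
    subgoal by (rule rid)
    subgoal by (rule conv) auto
    subgoal by (rule monotone_on_subset[OF T.R.conv_mono sub]) (auto dest: objD)
    subgoal by (rule T.R.rcomp_assoc) (auto dest: objD fibD)
    subgoal by (rule T.R.rid_left) (auto dest: objD fibD)
    subgoal by (rule T.R.rid_right) (auto dest: objD fibD)
    subgoal by (rule T.R.conv_rcomp) (auto dest: objD fibD)
    subgoal by (rule T.R.conv_rid) (auto dest: objD)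
    subgoal by (rule T.R.conv_conv) (auto dest: objD fibD)
    subgoal by (rule T.R.reindex_rcomp) (auto dest: objD homD fibD)
    subgoal by (rule T.R.reindex_rid) (auto dest: objD homD)
    subgoal by (rule T.R.reindex_conv) (auto dest: objD homD fibD)
    done
qed

end

theory Submission
  imports Defs
begin

text \<open>
  In an extensional doctrine an arrow \<open>f\<close> with \<open>ker q \<le> ker f\<close> factors through a split \<open>q\<close>
  as \<open>f \<circ> s \<circ> q\<close>, \<open>s\<close> being a section: \<open>\<Gamma>\<^sub>q ; \<Gamma>\<^sub>s \<le> ker q\<close> gives
  \<open>\<Gamma>\<^sub>q ; \<Gamma>\<^sub>s ; \<Gamma>\<^sub>f \<le> \<Gamma>\<^sub>f\<close>, and comparable graphs are equal.  Split arrows are preserved by \<open>T\<close>, so an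
  algebra morphism split in the base is a quotient arrow of its kernel among algebras.  If
  quotient arrows split, then the quotient \<open>q : X \<rightarrow> W\<close> of an \<open>R\<^sup>T\<close>-equivalence on \<open>(X, a)\<close> with section
  \<open>s\<close> carries the algebra structure \<open>q \<circ> a \<circ> T s\<close>; every quotient arrow of algebras splits in
  the base, which makes free algebras projective, and \<open>a : (T X, \<mu>\<^sub>X) \<rightarrow> (X, a)\<close> is split by \<open>\<eta>\<^sub>X\<close>.
  Conversely, the identity monad makes every object projective.
\<close>

lemma comp_fctr_simps [simp]:
  "ob (comp_fctr G F) X = ob G (ob F X)"
  "ar (comp_fctr G F) X Y f = ar G (ob F X) (ob F Y) (ar F X Y f)"
  by (simp_all add: comp_fctr_def)

lemma id_fctr_simps [simp]: "ob id_fctr X = X" "ar id_fctr X Y f = f"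
  by (simp_all add: id_fctr_def)

lemma id_map_simps: "Hat id_map = id_fctr" "Bar id_map X Y \<alpha> = \<alpha>"
  by (simp_all add: id_map_def)

section \<open>Graphs, kernels and split quotients\<close>

context relational_doctrine
begin

section \<open>Order reasoning in the fibres\<close>

lemmas closed = ident_arr cmp_arr reindex_closed rcomp_closed rid_closed conv_closed

lemma leq_reflI: "rel R X Y \<alpha> \<Longrightarrow> Leq R X Y \<alpha> \<alpha>"
  by (intro reflp_onD[OF leq_refl]) auto

lemma leq_transD:
  assumes "Leq R X Y \<alpha> \<beta>" "Leq R X Y \<beta> \<gamma>" "rel R X Y \<alpha>" "rel R X Y \<beta>" "rel R X Y \<gamma>"
  shows "Leq R X Y \<alpha> \<gamma>"
  using assms by - (rule transp_onD[OF leq_trans, of X Y _ \<beta>], auto)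

lemma leq_antisymD:
  assumes "Leq R X Y \<alpha> \<beta>" "Leq R X Y \<beta> \<alpha>" "rel R X Y \<alpha>" "rel R X Y \<beta>"
  shows "\<alpha> = \<beta>"
  using assms by - (rule antisymp_onD[OF leq_antisym, of X Y], auto)

lemma rcomp_mono_left:
  assumes "Leq R X Y \<alpha> \<alpha>'" "rel R X Y \<alpha>" "rel R X Y \<alpha>'" "rel R Y Z \<beta>"
  shows "Leq R X Z (RComp R X Y Z \<alpha> \<beta>) (RComp R X Y Z \<alpha>' \<beta>)"
  using assms by (intro rcomp_mono leq_reflI) auto

lemma rcomp_mono_right:
  assumes "Leq R Y Z \<beta> \<beta>'" "rel R X Y \<alpha>" "rel R Y Z \<beta>" "rel R Y Z \<beta>'"
  shows "Leq R X Z (RComp R X Y Z \<alpha> \<beta>) (RComp R X Y Z \<alpha> \<beta>')"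
  using assms by (intro rcomp_mono leq_reflI) auto

lemma conv_monoD:
  assumes "Leq R X Y \<alpha> \<beta>" "rel R X Y \<alpha>" "rel R X Y \<beta>"
  shows "Leq R Y X (Conv R X Y \<alpha>) (Conv R X Y \<beta>)"
  using assms by - (rule monotone_onD[OF conv_mono], auto)

section \<open>Graphs as total and single-valued relations\<close>

lemma graph_closed: "arr (Base R) X Y f \<Longrightarrow> graph R X Y f \<in> Fib R X Y"
  by (simp add: graph_def closed)

lemma ker_closed: "arr (Base R) X Y f \<Longrightarrow> ker R X Y f \<in> Fib R X X"
  by (simp add: ker_def closed graph_closed)

lemma graph_ident: "X \<in> Obj (Base R) \<Longrightarrow> graph R X X (Ident (Base R) X) = RId R X"
  by (simp add: graph_def reindex_ident closed)

text \<open>Lax naturality of the converse puts \<open>\<Gamma>\<^sub>f\<^sup>\<bottom>\<close>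
  below the reindexing of the identity relation \<open>d\<close> along \<open>(id, f)\<close>. Lax
  naturality of composition then bounds the composite by the reindexing of \<open>d ; d\<close>
  along identities, which is \<open>d\<close>.\<close>

lemma graph_single_valued:
  assumes f: "arr (Base R) X Y f"
  shows "Leq R Y Y (RComp R Y X Y (Conv R X Y (graph R X Y f)) (graph R X Y f)) (RId R Y)"
proof (rule leq_transD)
  let ?i = "Ident (Base R) Y" and ?d = "RId R Y"
  show "Leq R Y Y (RComp R Y X Y (Conv R X Y (graph R X Y f)) (graph R X Y f))
    (RComp R Y X Y (Reindex R Y Y X Y ?i f ?d) (graph R X Y f))"
    using f reindex_conv[of X Y f Y Y ?i ?d]
    by (intro rcomp_mono_left) (simp_all add: closed graph_closed conv_rid, simp add: graph_def)
  show "Leq R Y Y (RComp R Y X Y (Reindex R Y Y X Y ?i f ?d) (graph R X Y f)) ?d"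
    using f reindex_rcomp[of Y Y ?i X Y f Y Y ?i ?d ?d]
    by (simp add: graph_def closed rid_left reindex_ident)
qed (use f in \<open>simp_all add: closed graph_closed\<close>)

text \<open>This is totality of graphs. The reindexing \<open>k\<close> of the identity relation
  along \<open>(f, f)\<close> contains the identity and equals \<Gamma> of \<open>f\<close>
  reindexed along \<open>(id, f)\<close>. Its converse lies below
  \<open>\<Gamma>\<^sub>f\<^sup>\<bottom>\<close> reindexed along \<open>(f, id)\<close>, and
  composing the two bounds collapses the outer reindexings to identities.\<close>

lemma ker_refl:
  assumes f: "arr (Base R) X Y f"
  shows "Leq R X X (RId R X) (ker R X Y f)"
proof -
  let ?i = "Ident (Base R) X" and ?j = "Ident (Base R) Y" and ?d = "RId R Y"
  let ?G = "graph R X Y f" and ?k = "Reindex R X Y X Y f f ?d"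
  have k: "?k = Reindex R X X X Y ?i f ?G"
    using reindex_cmp[of X X ?i Y f X Y f Y ?j ?d] f
    by (simp add: graph_def closed cmp_ident_left cmp_ident_right)
  have conv_k: "Leq R X X (Conv R X X ?k) (Reindex R X Y X X f ?i (Conv R X Y ?G))"
    unfolding k using f by (intro reindex_conv) (simp_all add: closed graph_closed)
  have dk: "Leq R X X (RId R X) ?k"
    using f by (intro reindex_rid)
  have "Leq R X X (RId R X) (Conv R X X ?k)"
    using conv_monoD[OF dk] f by (simp add: closed conv_rid)
  then have dk': "Leq R X X (RId R X) (Reindex R X Y X X f ?i (Conv R X Y ?G))"
    by (rule leq_transD[OF _ conv_k]) (use f in \<open>simp_all add: closed graph_closed\<close>)
  have "Leq R X X (RComp R X X X (RId R X) (RId R X))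
      (RComp R X X X ?k (Reindex R X Y X X f ?i (Conv R X Y ?G)))"
    using f dk dk' by (intro rcomp_mono) (simp_all add: closed graph_closed)
  moreover have "Leq R X X (RComp R X X X ?k (Reindex R X Y X X f ?i (Conv R X Y ?G))) (ker R X Y f)"
    unfolding k using reindex_rcomp[of X X ?i X Y f X X ?i ?G "Conv R X Y ?G"] f
    by (simp add: closed graph_closed reindex_ident ker_def)
  ultimately show ?thesis
    using f leq_transD[of X X "RId R X" _ "ker R X Y f"]
    by (simp add: closed graph_closed ker_closed rid_left)
qed

text \<open>Functional relations are discretely ordered: \<beta> \<le>
  \<open>\<alpha> ; \<alpha>\<^sup>\<bottom> ; \<beta>\<close> \<le>
  \<open>\<alpha> ; \<beta>\<^sup>\<bottom> ; \<beta>\<close> \<le> \<alpha>. This turns the lax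
  axioms into equations between graphs.\<close>

lemma total_leq_single_valued_imp_eq:
  assumes le: "Leq R X Y \<alpha> \<beta>" and \<alpha>: "rel R X Y \<alpha>" and \<beta>: "rel R X Y \<beta>"
    and total: "Leq R X X (RId R X) (RComp R X Y X \<alpha> (Conv R X Y \<alpha>))"
    and single: "Leq R Y Y (RComp R Y X Y (Conv R X Y \<beta>) \<beta>) (RId R Y)"
  shows "\<alpha> = \<beta>"
proof -
  have "Leq R X Y (RComp R X X Y (RId R X) \<beta>) (RComp R X X Y (RComp R X Y X \<alpha> (Conv R X Y \<alpha>)) \<beta>)"
    using \<alpha> \<beta> by (intro rcomp_mono_left total) (simp_all add: closed)
  moreover have "Leq R X Y (RComp R X X Y (RComp R X Y X \<alpha> (Conv R X Y \<alpha>)) \<beta>)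
      (RComp R X X Y (RComp R X Y X \<alpha> (Conv R X Y \<beta>)) \<beta>)"
    using \<alpha> \<beta> by (intro rcomp_mono_left rcomp_mono_right conv_monoD le) (simp_all add: closed)
  moreover have "Leq R X Y (RComp R X X Y (RComp R X Y X \<alpha> (Conv R X Y \<beta>)) \<beta>) (RComp R X Y Y \<alpha> (RId R Y))"
    using rcomp_mono_right[OF single, of X \<alpha>] \<alpha> \<beta> by (simp add: closed rcomp_assoc)
  ultimately have "Leq R X Y (RComp R X X Y (RId R X) \<beta>) (RComp R X Y Y \<alpha> (RId R Y))"
    using \<alpha> \<beta> by (meson leq_transD closed)
  then have "Leq R X Y \<beta> \<alpha>"
    using \<alpha> \<beta> by (simp add: rid_left rid_right)
  then show ?thesis using leq_antisymD le \<alpha> \<beta> by blast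
qed

lemma graph_leq_imp_eq:
  assumes "arr (Base R) X Y f" "arr (Base R) X Y g" "Leq R X Y (graph R X Y f) (graph R X Y g)"
  shows "graph R X Y f = graph R X Y g"
  using assms ker_refl[of X Y f, unfolded ker_def] graph_single_valued[of X Y g]
  by (intro total_leq_single_valued_imp_eq) (simp_all add: graph_closed)

text \<open>Totality of the graph of \<open>g\<close> is inserted between the graph of
  \<open>f\<close> and its converse. It serves to make the composite of two graphs total.\<close>

lemma ker_leq_rcomp:
  assumes f: "arr (Base R) X Y f" and g: "arr (Base R) Y Z g"
  shows "Leq R X X (ker R X Y f)
    (RComp R X Z X (RComp R X Y Z (graph R X Y f) (graph R Y Z g))
      (Conv R X Z (RComp R X Y Z (graph R X Y f) (graph R Y Z g))))"
proof -
  let ?f = "graph R X Y f" and ?g = "graph R Y Z g"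
  have "Leq R X X (RComp R X Y X (RComp R X Y Y ?f (RId R Y)) (Conv R X Y ?f))
      (RComp R X Y X (RComp R X Y Y ?f (ker R Y Z g)) (Conv R X Y ?f))"
    using f g by (intro rcomp_mono_left rcomp_mono_right ker_refl) (simp_all add: closed graph_closed ker_closed)
  moreover have "RComp R X Y X (RComp R X Y Y ?f (ker R Y Z g)) (Conv R X Y ?f) =
      RComp R X Z X (RComp R X Y Z ?f ?g) (Conv R X Z (RComp R X Y Z ?f ?g))"
    using f g by (simp add: ker_def closed graph_closed rcomp_assoc conv_rcomp)
  ultimately show ?thesis
    using f by (simp add: ker_def graph_closed rid_right)
qed

text \<open>The axioms give only the inequality from left-hand composite of graphs to graph of the
  composite arrow. Since the former is total and the latter single-valued, they coincide.\<close>

lemma graph_cmp: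
  assumes f: "arr (Base R) X Y f" and g: "arr (Base R) Y Z g"
  shows "graph R X Z (Cmp (Base R) X Y Z g f) = RComp R X Y Z (graph R X Y f) (graph R Y Z g)"
proof (rule total_leq_single_valued_imp_eq[symmetric])
  let ?f = "graph R X Y f" and ?g = "graph R Y Z g"
  let ?i = "Ident (Base R) Y" and ?j = "Ident (Base R) Z"
  have "Reindex R X Y Z Z f ?j ?g = graph R X Z (Cmp (Base R) X Y Z g f)"
    using reindex_cmp[of X Y f Z g Z Z ?j Z ?j "RId R Z"] f g
    by (simp add: graph_def closed cmp_ident_left)
  then show "Leq R X Z (RComp R X Y Z ?f ?g) (graph R X Z (Cmp (Base R) X Y Z g f))"
    using reindex_rcomp[of X Y f Y Y ?i Z Z ?j "RId R Y" ?g] f g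
    by (simp add: closed graph_closed rid_left reindex_ident flip: graph_def)
  show "Leq R X X (RId R X) (RComp R X Z X (RComp R X Y Z ?f ?g) (Conv R X Z (RComp R X Y Z ?f ?g)))"
    using f g by (intro leq_transD[OF ker_refl ker_leq_rcomp]) (simp_all add: closed graph_closed ker_closed)
  show "Leq R Z Z (RComp R Z X Z (Conv R X Z (graph R X Z (Cmp (Base R) X Y Z g f)))
     (graph R X Z (Cmp (Base R) X Y Z g f))) (RId R Z)"
    using f g by (intro graph_single_valued) (simp add: closed)
qed (use f g in \<open>simp_all add: closed graph_closed\<close>)

lemma equivalence_ker:
  assumes f: "arr (Base R) X Y f"
  shows "equivalence R X (ker R X Y f)"
  unfolding equivalence_def
proof (intro conjI)
  let ?f = "graph R X Y f" and ?c = "Conv R X Y (graph R X Y f)"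
  show "Leq R X X (Conv R X X (ker R X Y f)) (ker R X Y f)"
    using f by (simp add: ker_def conv_rcomp conv_conv closed graph_closed leq_reflI)
  have "Leq R X X (RComp R X Y X (RComp R X Y Y ?f (RComp R Y X Y ?c ?f)) ?c)
      (RComp R X Y X (RComp R X Y Y ?f (RId R Y)) ?c)"
    using f by (intro rcomp_mono_left rcomp_mono_right graph_single_valued) (simp_all add: closed graph_closed)
  then show "Leq R X X (RComp R X X X (ker R X Y f) (ker R X Y f)) (ker R X Y f)"
    using f by (simp add: ker_def rcomp_assoc rid_right closed graph_closed)
qed (use f in \<open>simp_all add: ker_closed ker_refl\<close>)

section \<open>Arrows with a section\<close>

text \<open>Totality of \<open>q\<close> gives \<open>\<Gamma>\<^sub>s\<close> \<le>
  \<open>\<Gamma>\<^sub>s ; \<Gamma>\<^sub>q ; \<Gamma>\<^sub>q\<^sup>\<bottom>\<close>, and the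
  first two factors compose to the identity relation.\<close>

lemma graph_section_leq_conv:
  assumes q: "arr (Base R) X W q" and s: "arr (Base R) W X s"
    and qs: "Cmp (Base R) W X W q s = Ident (Base R) W"
  shows "Leq R W X (graph R W X s) (Conv R X W (graph R X W q))"
proof -
  have "Leq R W X (RComp R W X X (graph R W X s) (RId R X)) (RComp R W X X (graph R W X s) (ker R X W q))"
    using q s by (intro rcomp_mono_right ker_refl) (simp_all add: closed graph_closed ker_closed)
  moreover have "RComp R W X X (graph R W X s) (ker R X W q) = Conv R X W (graph R X W q)"
    using q s by (simp add: ker_def rcomp_assoc rid_left closed graph_closed graph_ident flip: graph_cmp qs)
      (simp add: qs graph_ident rid_left closed graph_closed)
  ultimately show ?thesis using q s by (simp add: rid_right graph_closed)
qed

text \<open>One inequality is single-valuedness. For the other, the identity relation is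
  \<open>\<Gamma>\<^sub>s ; \<Gamma>\<^sub>q\<close>, where \<open>\<Gamma>\<^sub>s\<close> lies
  below \<open>\<Gamma>\<^sub>q\<^sup>\<bottom>\<close>.\<close>

lemma splits_descent:
  assumes q: "arr (Base R) X W q" and "splits (Base R) X W q"
  shows "descent R X W q"
proof -
  obtain s where s: "arr (Base R) W X s" and qs: "Cmp (Base R) W X W q s = Ident (Base R) W"
    using assms unfolding splits_def by blast
  have "Leq R W W (RComp R W X W (graph R W X s) (graph R X W q))
      (RComp R W X W (Conv R X W (graph R X W q)) (graph R X W q))"
    using q s by (intro rcomp_mono_left graph_section_leq_conv qs) (simp_all add: closed graph_closed)
  then have "Leq R W W (RId R W) (RComp R W X W (Conv R X W (graph R X W q)) (graph R X W q))"
    using q s qs by (simp add: graph_ident flip: graph_cmp)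
  then show ?thesis
    unfolding descent_def by (rule leq_antisymD[OF graph_single_valued[OF q]])
      (use q in \<open>simp_all add: closed graph_closed\<close>)
qed

lemma factor_through_section:
  assumes ext: "extensional R"
    and q: "arr (Base R) X W q" and s: "arr (Base R) W X s"
    and qs: "Cmp (Base R) W X W q s = Ident (Base R) W"
    and f: "arr (Base R) X Z f" and le: "Leq R X X (ker R X W q) (ker R X Z f)"
  shows "Cmp (Base R) X W Z (Cmp (Base R) W X Z f s) q = f"
proof -
  let ?q = "graph R X W q" and ?s = "graph R W X s" and ?f = "graph R X Z f"
  have "Leq R X X (RComp R X W X ?q ?s) (ker R X W q)"
    unfolding ker_def using q s
    by (intro rcomp_mono_right graph_section_leq_conv qs) (simp_all add: closed graph_closed)
  then have "Leq R X X (RComp R X W X ?q ?s) (ker R X Z f)"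
    by (rule leq_transD[OF _ le]) (use q s f in \<open>simp_all add: closed graph_closed ker_closed\<close>)
  then have "Leq R X Z (RComp R X X Z (RComp R X W X ?q ?s) ?f) (RComp R X X Z (ker R X Z f) ?f)"
    using q s f by (intro rcomp_mono_left) (simp_all add: closed graph_closed ker_closed)
  \<comment> \<open>Reassociated, the left side is \<open>\<Gamma>\<^sub>f ;
    (\<Gamma>\<^sub>f\<^sup>\<bottom> ; \<Gamma>\<^sub>f)\<close>, so single-valuedness absorbs the
    bracket.\<close>
  moreover have "Leq R X Z (RComp R X X Z (ker R X Z f) ?f) ?f"
    using rcomp_mono_right[OF graph_single_valued[OF f], of X ?f] f
    by (simp add: ker_def closed graph_closed rcomp_assoc rid_right)
  ultimately have "Leq R X Z (RComp R X X Z (RComp R X W X ?q ?s) ?f) ?f"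
    by (rule leq_transD) (use q s f in \<open>simp_all add: closed graph_closed ker_closed\<close>)
  moreover have "RComp R X X Z (RComp R X W X ?q ?s) ?f =
      graph R X Z (Cmp (Base R) X W Z (Cmp (Base R) W X Z f s) q)"
    using q s f by (simp add: graph_cmp closed graph_closed rcomp_assoc)
  ultimately have "graph R X Z (Cmp (Base R) X W Z (Cmp (Base R) W X Z f s) q) = ?f"
    using q s f by (intro graph_leq_imp_eq) (simp_all add: closed)
  then show ?thesis
    using ext q s f unfolding extensional_def by (meson cmp_arr)
qed

text \<open>The usual comparison of two solutions of one universal problem. Of the two inverse laws
  only the one making \<open>i\<close> a split epimorphism is recorded: it carries a section of
  \<open>q\<close> over to \<open>q'\<close>.\<close>

lemma quotient_arrow_of_factor:
  assumes q: "quotient_arrow_of R X \<rho> W q" and q': "quotient_arrow_of R X \<rho> W' q'"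
  obtains i j where "arr (Base R) W W' i" "arr (Base R) W' W j"
    "Cmp (Base R) X W W' i q = q'" "Cmp (Base R) W' W W' i j = Ident (Base R) W'"
proof -
  let ?C = "Base R"
  have aq: "arr ?C X W q" "Leq R X X \<rho> (ker R X W q)"
    and aq': "arr ?C X W' q'" "Leq R X X \<rho> (ker R X W' q')"
    using q q' unfolding quotient_arrow_of_def by blast+
  have ex: "\<exists>!h. arr ?C V Z h \<and> f = Cmp ?C X V Z h p"
    if "quotient_arrow_of R X \<rho> V p" "arr ?C X Z f" "Leq R X X \<rho> (ker R X Z f)" for V Z p f
    using that unfolding quotient_arrow_of_def by blast
  obtain i where i: "arr ?C W W' i" "q' = Cmp ?C X W W' i q"
    using ex1_implies_ex[OF ex[OF q aq']] by blast
  obtain j where j: "arr ?C W' W j" "q = Cmp ?C X W' W j q'"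
    using ex1_implies_ex[OF ex[OF q' aq]] by blast
  have "Cmp ?C X W' W' (Cmp ?C W' W W' i j) q' = q'"
    using cmp_assoc[OF aq'(1) j(1) i(1)] by (simp only: j(2)[symmetric] i(2)[symmetric])
  moreover have "arr ?C W' W' (Cmp ?C W' W W' i j)"
    using i j by (simp add: closed)
  moreover have "arr ?C W' W' (Ident ?C W')" "q' = Cmp ?C X W' W' (Ident ?C W') q'"
    using aq' by (simp_all add: closed cmp_ident_left)
  ultimately have "Cmp ?C W' W W' i j = Ident ?C W'"
    using ex1E[OF ex[OF q' aq']] by metis
  then show thesis
    by (rule that[OF i(1) j(1) i(2)[symmetric]])
qed

text \<open>An arrow \<open>k\<close> is recovered from \<open>k \<circ> q\<close> by composing with
  the section. Equations between algebra structures are later checked after precomposition with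
  split arrows.\<close>

lemma splits_epi:
  assumes "splits (Base R) X W q" and "arr (Base R) X W q"
    and "arr (Base R) W Z g" "arr (Base R) W Z h"
    and "Cmp (Base R) X W Z g q = Cmp (Base R) X W Z h q"
  shows "g = h"
proof -
  obtain s where s: "arr (Base R) W X s" "Cmp (Base R) W X W q s = Ident (Base R) W"
    using assms(1) unfolding splits_def by blast
  have "k = Cmp (Base R) W X Z (Cmp (Base R) X W Z k q) s" if "arr (Base R) W Z k" for k
    using s assms(2) that by (simp add: cmp_assoc cmp_ident_right)
  then show ?thesis using assms by metis
qed

text \<open>Totality gives \<alpha> \<le> \<open>ker f ; \<alpha> ; ker g\<close>, whose middle part
  is the relation bounded by \<beta>. Applied to structure maps, this turns the fibre condition of
  the algebra doctrine into a bound on the image of a relation under \<open>T\<close>.\<close>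

lemma conj_graph_leq_imp_leq:
  assumes f: "arr (Base R) A X f" and g: "arr (Base R) B Y g"
    and \<alpha>: "\<alpha> \<in> Fib R A B" and \<beta>: "\<beta> \<in> Fib R X Y"
    and le: "Leq R X Y (RComp R X B Y (RComp R X A B (Conv R A X (graph R A X f)) \<alpha>) (graph R B Y g)) \<beta>"
  shows "Leq R A B \<alpha> (RComp R A Y B (RComp R A X Y (graph R A X f) \<beta>) (Conv R B Y (graph R B Y g)))"
proof -
  let ?f = "graph R A X f" and ?g = "graph R B Y g"
  let ?m = "RComp R X B Y (RComp R X A B (Conv R A X ?f) \<alpha>) ?g"
  have "Leq R A B (RComp R A B B (RComp R A A B (RId R A) \<alpha>) (RId R B))
    (RComp R A B B (RComp R A A B (ker R A X f) \<alpha>) (ker R B Y g))"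
    using f g \<alpha> by (intro rcomp_mono leq_reflI ker_refl) (simp_all add: closed ker_closed)
  moreover have "RComp R A B B (RComp R A A B (ker R A X f) \<alpha>) (ker R B Y g) =
    RComp R A Y B (RComp R A X Y ?f ?m) (Conv R B Y ?g)"
    using f g \<alpha> by (simp add: ker_def closed graph_closed rcomp_assoc)
  moreover have "Leq R A B (RComp R A Y B (RComp R A X Y ?f ?m) (Conv R B Y ?g))
    (RComp R A Y B (RComp R A X Y ?f \<beta>) (Conv R B Y ?g))"
    using f g \<alpha> \<beta> by (intro rcomp_mono_left rcomp_mono_right le) (simp_all add: closed graph_closed)
  ultimately show ?thesis
    using f g \<alpha> \<beta> leq_transD[of A B \<alpha>] by (simp add: closed graph_closed rid_left rid_right)
qed

end

section \<open>Algebras for a doctrine monad\<close>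

context doctrine_monad
begin

section \<open>The Eilenberg-Moore doctrine unfolded\<close>

abbreviation "E \<equiv> em_doctrine R T \<eta> \<mu>"
abbreviation "\<C> \<equiv> Base R"
abbreviation "T\<^sub>0 \<equiv> ob (Hat T)"
abbreviation "T\<^sub>1 \<equiv> ar (Hat T)"

lemmas arrows = T.R.closed T.Hat.ob_closed T.Hat.ar_closed

lemma em_Obj_iff: "(X, a) \<in> Obj (Base E) \<longleftrightarrow> arr \<C> (T\<^sub>0 X) X a \<and>
    Cmp \<C> X (T\<^sub>0 X) X a (\<eta> X) = Ident \<C> X \<and>
    Cmp \<C> (T\<^sub>0 (T\<^sub>0 X)) (T\<^sub>0 X) X a (T\<^sub>1 (T\<^sub>0 X) X a) = Cmp \<C> (T\<^sub>0 (T\<^sub>0 X)) (T\<^sub>0 X) X a (\<mu> X)"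
  by (auto simp: em_doctrine_def em_category_def)

lemma em_Hom_iff: "f \<in> Hom (Base E) (X, a) (Y, b) \<longleftrightarrow> f \<in> Hom \<C> X Y \<and>
    Cmp \<C> (T\<^sub>0 X) X Y f a = Cmp \<C> (T\<^sub>0 X) (T\<^sub>0 Y) Y b (T\<^sub>1 X Y f)"
  by (simp add: em_doctrine_def em_category_def)

lemma em_Fib_iff: "\<alpha> \<in> Fib E (X, a) (Y, b) \<longleftrightarrow> \<alpha> \<in> Fib R X Y \<and>
    Leq R X Y (RComp R X (T\<^sub>0 Y) Y
      (RComp R X (T\<^sub>0 X) (T\<^sub>0 Y) (Conv R (T\<^sub>0 X) X (graph R (T\<^sub>0 X) X a)) (Bar T X Y \<alpha>))
      (graph R (T\<^sub>0 Y) Y b)) \<alpha>"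
  by (simp add: em_doctrine_def Let_def)

lemma em_simps [simp]:
  "Leq E (X, a) (Y, b) = Leq R X Y" "Reindex E (A, c) (X, a) (B, d) (Y, b) = Reindex R A X B Y"
  "RComp E (X, a) (Y, b) (Z, e) = RComp R X Y Z" "RId E (X, a) = RId R X"
  "Conv E (X, a) (Y, b) = Conv R X Y" "Ident (Base E) (X, a) = Ident \<C> X"
  "Cmp (Base E) (X, a) (Y, b) (Z, e) = Cmp \<C> X Y Z"
  by (simp_all add: em_doctrine_def em_category_def)

lemma em_graph [simp]: "graph E (X, a) (Y, b) f = graph R X Y f"
  by (simp add: graph_def)

lemma em_ker [simp]: "ker E (X, a) (Y, b) f = ker R X Y f"
  by (simp add: ker_def)

lemma em_descent [simp]: "descent E (X, a) (Y, b) q = descent R X Y q"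
  by (simp add: descent_def)

lemma em_equivalenceD: "equivalence E (X, a) \<rho> \<Longrightarrow> equivalence R X \<rho>"
  by (auto simp: equivalence_def em_Obj_iff em_Fib_iff)

sublocale EM: relational_doctrine E
  by (rule relational_doctrine_em_doctrine) (rule doctrine_monad_axioms)

section \<open>Unit, multiplication and the action of the monad\<close>

lemma \<eta>_closed: "X \<in> Obj \<C> \<Longrightarrow> \<eta> X \<in> Hom \<C> X (T\<^sub>0 X)"
  using Hat.\<eta>.comp_closed[of X] by simp

lemma \<mu>_closed: "X \<in> Obj \<C> \<Longrightarrow> \<mu> X \<in> Hom \<C> (T\<^sub>0 (T\<^sub>0 X)) (T\<^sub>0 X)"
  using Hat.\<mu>.comp_closed[of X] by simp

lemma \<eta>_natural: "arr \<C> X Y f \<Longrightarrow> Cmp \<C> X Y (T\<^sub>0 Y) (\<eta> Y) f = Cmp \<C> X (T\<^sub>0 X) (T\<^sub>0 Y) (T\<^sub>1 X Y f) (\<eta> X)"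
  using Hat.\<eta>.naturality[of X Y f] by simp

lemma \<mu>_natural: "arr \<C> X Y f \<Longrightarrow>
  Cmp \<C> (T\<^sub>0 (T\<^sub>0 X)) (T\<^sub>0 (T\<^sub>0 Y)) (T\<^sub>0 Y) (\<mu> Y) (T\<^sub>1 (T\<^sub>0 X) (T\<^sub>0 Y) (T\<^sub>1 X Y f)) =
  Cmp \<C> (T\<^sub>0 (T\<^sub>0 X)) (T\<^sub>0 X) (T\<^sub>0 Y) (T\<^sub>1 X Y f) (\<mu> X)"
  using Hat.\<mu>.naturality[of X Y f] by simp

lemma free_algebra_in_Obj: "X \<in> Obj \<C> \<Longrightarrow> (T\<^sub>0 X, \<mu> X) \<in> Obj (Base E)"
  using Hat.unit_left[of X] Hat.mult_assoc[of X]
  by (simp add: em_Obj_iff arrows \<mu>_closed)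

lemma bar_graph:
  assumes "arr \<C> X Y f"
  shows "Bar T X Y (graph R X Y f) = graph R (T\<^sub>0 X) (T\<^sub>0 Y) (T\<^sub>1 X Y f)"
  using assms by (simp add: graph_def T.bar_natural T.bar_rid T.Hat.ar_ident arrows)

text \<open>Kernels are built from operations that 1-arrows preserve. This identifies the image of
  an effective equivalence with the kernel of \<open>T q\<close>.\<close>

lemma bar_ker:
  assumes "arr \<C> X Y f"
  shows "Bar T X X (ker R X Y f) = ker R (T\<^sub>0 X) (T\<^sub>0 Y) (T\<^sub>1 X Y f)"
  using assms by (simp add: ker_def T.bar_rcomp T.bar_conv bar_graph arrows T.R.graph_closed)

lemma splits_map:
  assumes q: "arr \<C> X W q" and "splits \<C> X W q"
  shows "splits \<C> (T\<^sub>0 X) (T\<^sub>0 W) (T\<^sub>1 X W q)"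
proof -
  obtain s where s: "arr \<C> W X s" "Cmp \<C> W X W q s = Ident \<C> W"
    using assms unfolding splits_def by blast
  then have "Cmp \<C> (T\<^sub>0 W) (T\<^sub>0 X) (T\<^sub>0 W) (T\<^sub>1 X W q) (T\<^sub>1 W X s) = Ident \<C> (T\<^sub>0 W)"
    using q by (simp add: T.Hat.ar_ident flip: T.Hat.ar_cmp)
  then show ?thesis
    unfolding splits_def using s by (intro exI[of _ "T\<^sub>1 W X s"]) (simp add: arrows)
qed

section \<open>Quotients of algebras\<close>

text \<open>Since \<open>q\<close> and \<open>h \<circ> q\<close> are morphisms, the two sides of
  the morphism equation for \<open>h\<close> agree after precomposition with \<open>T q\<close>,
  which is split and hence can be cancelled.\<close>

lemma em_Hom_factor:
  assumes q: "arr (Base E) (X, a) (W, w) q" and sp: "splits \<C> X W q"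
    and f: "arr (Base E) (X, a) (Z, c) f" and h: "arr \<C> W Z h" and fh: "Cmp \<C> X W Z h q = f"
  shows "h \<in> Hom (Base E) (W, w) (Z, c)"
proof -
  have o: "arr \<C> (T\<^sub>0 X) X a" "arr \<C> (T\<^sub>0 W) W w" "arr \<C> (T\<^sub>0 Z) Z c"
    "arr \<C> X W q" "arr \<C> X Z f"
    using q f by (auto simp: em_Obj_iff em_Hom_iff)
  have qa: "Cmp \<C> (T\<^sub>0 X) X W q a = Cmp \<C> (T\<^sub>0 X) (T\<^sub>0 W) W w (T\<^sub>1 X W q)"
    and fa: "Cmp \<C> (T\<^sub>0 X) X Z f a = Cmp \<C> (T\<^sub>0 X) (T\<^sub>0 Z) Z c (T\<^sub>1 X Z f)"
    using q f by (auto simp: em_Hom_iff)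
  have Th: "T\<^sub>1 X Z f = Cmp \<C> (T\<^sub>0 X) (T\<^sub>0 W) (T\<^sub>0 Z) (T\<^sub>1 W Z h) (T\<^sub>1 X W q)"
    unfolding fh[symmetric] by (rule T.Hat.ar_cmp) (use o h in simp_all)
  have "Cmp \<C> (T\<^sub>0 X) (T\<^sub>0 W) Z (Cmp \<C> (T\<^sub>0 W) W Z h w) (T\<^sub>1 X W q) =
      Cmp \<C> (T\<^sub>0 X) W Z h (Cmp \<C> (T\<^sub>0 X) X W q a)"
    unfolding qa by (rule T.R.cmp_assoc) (use o h in \<open>simp_all add: arrows\<close>)
  also have "\<dots> = Cmp \<C> (T\<^sub>0 X) X Z f a"
    unfolding fh[symmetric] by (rule T.R.cmp_assoc[symmetric]) (use o h in simp_all)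
  also have "\<dots> = Cmp \<C> (T\<^sub>0 X) (T\<^sub>0 W) Z (Cmp \<C> (T\<^sub>0 W) (T\<^sub>0 Z) Z c (T\<^sub>1 W Z h)) (T\<^sub>1 X W q)"
    unfolding fa Th by (rule T.R.cmp_assoc[symmetric]) (use o h in \<open>simp_all add: arrows\<close>)
  finally have "Cmp \<C> (T\<^sub>0 W) W Z h w = Cmp \<C> (T\<^sub>0 W) (T\<^sub>0 Z) Z c (T\<^sub>1 W Z h)"
    by (rule T.R.splits_epi[OF splits_map[OF _ sp], rotated 4]) (use o h in \<open>simp_all add: arrows\<close>)
  then show ?thesis using h by (simp add: em_Hom_iff)
qed

text \<open>The section \<open>s\<close> is only an arrow of the base, yet the factor
  \<open>f \<circ> s\<close> is an algebra morphism by \<open>em_Hom_factor\<close>. Uniqueness is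
  inherited from the base, where \<open>q\<close> is epic.\<close>

lemma em_quotient_of_ker:
  assumes ext: "extensional R"
    and q: "arr (Base E) (X, a) (W, w) q" and sp: "splits \<C> X W q"
  shows "quotient_arrow_of E (X, a) (ker R X W q) (W, w) q"
proof -
  have q': "arr \<C> X W q" using q by (auto simp: em_Obj_iff em_Hom_iff)
  obtain s where s: "arr \<C> W X s" and qs: "Cmp \<C> W X W q s = Ident \<C> W"
    using sp unfolding splits_def by blast
  have "\<exists>!h. arr (Base E) (W, w) (Z, c) h \<and> f = Cmp \<C> X W Z h q"
    if f: "arr (Base E) (X, a) (Z, c) f" and le: "Leq R X X (ker R X W q) (ker R X Z f)" for Z c f
  proof -
    have f': "arr \<C> X Z f" using f by (simp add: em_Obj_iff em_Hom_iff)
    let ?h = "Cmp \<C> W X Z f s"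
    have h: "arr \<C> W Z ?h" using f' s by (simp add: arrows)
    have hq: "Cmp \<C> X W Z ?h q = f"
      by (rule T.R.factor_through_section[OF ext q' s qs f' le])
    have "arr (Base E) (W, w) (Z, c) ?h"
      using em_Hom_factor[OF q sp f h hq] q f by simp
    moreover have "k = ?h" if "arr (Base E) (W, w) (Z, c) k" and fk: "f = Cmp \<C> X W Z k q" for k
    proof (rule T.R.splits_epi[OF sp q' _ h])
      show "arr \<C> W Z k" using that(1) h by (simp add: em_Hom_iff)
      show "Cmp \<C> X W Z k q = Cmp \<C> X W Z ?h q" by (rule trans[OF fk[symmetric] hq[symmetric]])
    qed
    ultimately show ?thesis
      by (intro ex1I[of _ ?h] conjI) (auto simp only: hq)
  qed
  then show ?thesis
    unfolding quotient_arrow_of_def split_paired_All em_simps em_ker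
    using q T.R.leq_reflI[of X X "ker R X W q"] T.R.ker_closed[OF q'] q'
    by (intro conjI allI impI) (simp_all only: simp_thms)
qed

text \<open>The structure map \<open>w\<close> on the base quotient is forced by
  \<open>w \<circ> T q = q \<circ> a\<close>. It exists because the fibre condition on \<rho> makes
  the kernel of \<open>T q\<close> smaller than that of \<open>q \<circ> a\<close>.\<close>

lemma em_quotient_exists:
  assumes ext: "extensional R" and quot: "has_quotients R"
    and ch: "\<forall>X W q. quotient_arrow R X W q \<longrightarrow> splits \<C> X W q"
    and eq: "equivalence E (X, a) \<rho>"
  obtains W w q where "quotient_arrow_of E (X, a) \<rho> (W, w) q" "\<rho> = ker R X W q"
    "splits \<C> X W q"
proof -
  have a: "arr \<C> (T\<^sub>0 X) X a" and a\<eta>: "Cmp \<C> X (T\<^sub>0 X) X a (\<eta> X) = Ident \<C> X"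
    and a\<mu>: "Cmp \<C> (T\<^sub>0 (T\<^sub>0 X)) (T\<^sub>0 X) X a (T\<^sub>1 (T\<^sub>0 X) X a) = Cmp \<C> (T\<^sub>0 (T\<^sub>0 X)) (T\<^sub>0 X) X a (\<mu> X)"
    and \<rho>: "\<rho> \<in> Fib E (X, a) (X, a)"
    using eq by (simp_all add: equivalence_def em_Obj_iff)
  \<comment> \<open>Effectiveness makes \<rho> the kernel of \<open>q\<close>, so it suffices to
    make \<open>q\<close> a morphism of algebras.\<close>
  obtain W q where q0: "quotient_arrow_of R X \<rho> W q" and \<rho>_def: "\<rho> = ker R X W q"
    using quot em_equivalenceD[OF eq] unfolding has_quotients_def effective_def by blast
  have q: "arr \<C> X W q" using q0 by (simp add: quotient_arrow_of_def)
  have sp: "splits \<C> X W q"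
    using ch em_equivalenceD[OF eq] q0 unfolding quotient_arrow_def by blast
  let ?Tq = "T\<^sub>1 X W q" and ?qa = "Cmp \<C> (T\<^sub>0 X) X W q a"
  have Tq: "arr \<C> (T\<^sub>0 X) (T\<^sub>0 W) ?Tq" and qa: "arr \<C> (T\<^sub>0 X) W ?qa"
    using q a by (simp_all add: arrows)
  have spT: "splits \<C> (T\<^sub>0 X) (T\<^sub>0 W) ?Tq"
    by (rule splits_map[OF q sp])
  have spTT: "splits \<C> (T\<^sub>0 (T\<^sub>0 X)) (T\<^sub>0 (T\<^sub>0 W)) (T\<^sub>1 (T\<^sub>0 X) (T\<^sub>0 W) ?Tq)"
    by (rule splits_map[OF Tq spT])
  obtain t where t: "arr \<C> (T\<^sub>0 W) (T\<^sub>0 X) t" and Tqt: "Cmp \<C> (T\<^sub>0 W) (T\<^sub>0 X) (T\<^sub>0 W) ?Tq t = Ident \<C> (T\<^sub>0 W)"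
    using spT unfolding splits_def by blast
  \<comment> \<open>The fibre condition, transposed along \<open>a\<close> on both sides, bounds the
    image of \<rho> under \<open>T\<close> by
    \<open>\<Gamma>\<^sub>a ; \<rho> ; \<Gamma>\<^sub>a\<^sup>\<bottom>\<close>, the kernel of
    \<open>q \<circ> a\<close>.\<close>
  have "Leq R (T\<^sub>0 X) (T\<^sub>0 X) (Bar T X X \<rho>)
      (RComp R (T\<^sub>0 X) X (T\<^sub>0 X) (RComp R (T\<^sub>0 X) X X (graph R (T\<^sub>0 X) X a) \<rho>)
        (Conv R (T\<^sub>0 X) X (graph R (T\<^sub>0 X) X a)))"
    using \<rho> a by (intro T.R.conj_graph_leq_imp_leq) (simp_all add: em_Fib_iff T.bar_closed)
  also have "\<dots> = ker R (T\<^sub>0 X) W ?qa"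
    using a q by (simp add: \<rho>_def ker_def T.R.graph_cmp T.R.conv_rcomp T.R.rcomp_assoc
        T.R.closed T.R.graph_closed)
  finally have "Leq R (T\<^sub>0 X) (T\<^sub>0 X) (ker R (T\<^sub>0 X) (T\<^sub>0 W) ?Tq) (ker R (T\<^sub>0 X) W ?qa)"
    using q by (simp add: \<rho>_def bar_ker)
  note fac = T.R.factor_through_section[OF ext Tq t Tqt qa this]
  define w where "w = Cmp \<C> (T\<^sub>0 W) (T\<^sub>0 X) W ?qa t"
  have w: "arr \<C> (T\<^sub>0 W) W w" using qa t by (simp add: w_def arrows)
  have wTq: "Cmp \<C> (T\<^sub>0 X) (T\<^sub>0 W) W w ?Tq = ?qa"
    using fac by (simp add: w_def)
  \<comment> \<open>Precomposing with \<open>q\<close> moves the law, by naturality of \<eta>, to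
    the unit law of \<open>a\<close>.\<close>
  have unit: "Cmp \<C> W (T\<^sub>0 W) W w (\<eta> W) = Ident \<C> W"
  proof (rule T.R.splits_epi[OF sp q])
    have "Cmp \<C> X W W (Cmp \<C> W (T\<^sub>0 W) W w (\<eta> W)) q = Cmp \<C> X (T\<^sub>0 W) W w (Cmp \<C> X W (T\<^sub>0 W) (\<eta> W) q)"
      by (rule T.R.cmp_assoc) (use q w in \<open>simp_all add: \<eta>_closed\<close>)
    also have "\<dots> = Cmp \<C> X (T\<^sub>0 X) W (Cmp \<C> (T\<^sub>0 X) (T\<^sub>0 W) W w ?Tq) (\<eta> X)"
      unfolding \<eta>_natural[OF q] by (rule T.R.cmp_assoc[symmetric]) (use q w in \<open>simp_all add: \<eta>_closed arrows\<close>)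
    also have "\<dots> = Cmp \<C> X X W q (Cmp \<C> X (T\<^sub>0 X) X a (\<eta> X))"
      unfolding wTq by (rule T.R.cmp_assoc) (use q a in \<open>simp_all add: \<eta>_closed\<close>)
    also have "\<dots> = Cmp \<C> X W W (Ident \<C> W) q"
      using q by (simp add: a\<eta> T.R.cmp_ident_left T.R.cmp_ident_right)
    finally show "Cmp \<C> X W W (Cmp \<C> W (T\<^sub>0 W) W w (\<eta> W)) q = Cmp \<C> X W W (Ident \<C> W) q" .
  qed (use q w in \<open>simp_all add: \<eta>_closed arrows\<close>)
  \<comment> \<open>Precomposing with \<open>T (T q)\<close> moves the law to the associativity law
    of \<open>a\<close>, by naturality of \<mu>.\<close>
  have mult: "Cmp \<C> (T\<^sub>0 (T\<^sub>0 W)) (T\<^sub>0 W) W w (T\<^sub>1 (T\<^sub>0 W) W w) = Cmp \<C> (T\<^sub>0 (T\<^sub>0 W)) (T\<^sub>0 W) W w (\<mu> W)"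
  proof (rule T.R.splits_epi[OF spTT])
    let ?TTX = "T\<^sub>0 (T\<^sub>0 X)" and ?TTW = "T\<^sub>0 (T\<^sub>0 W)" and ?TTq = "T\<^sub>1 (T\<^sub>0 X) (T\<^sub>0 W) ?Tq"
    let ?Tw = "T\<^sub>1 (T\<^sub>0 W) W w" and ?Ta = "T\<^sub>1 (T\<^sub>0 X) X a"
    have TwTTq: "Cmp \<C> ?TTX ?TTW (T\<^sub>0 W) ?Tw ?TTq = Cmp \<C> ?TTX (T\<^sub>0 X) (T\<^sub>0 W) ?Tq ?Ta"
      using T.Hat.ar_cmp[OF Tq w] T.Hat.ar_cmp[OF a q] wTq by simp
    have "Cmp \<C> ?TTX ?TTW W (Cmp \<C> ?TTW (T\<^sub>0 W) W w ?Tw) ?TTq =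
        Cmp \<C> ?TTX (T\<^sub>0 W) W w (Cmp \<C> ?TTX ?TTW (T\<^sub>0 W) ?Tw ?TTq)"
      by (rule T.R.cmp_assoc) (use Tq w in \<open>simp_all add: arrows\<close>)
    also have "\<dots> = Cmp \<C> ?TTX (T\<^sub>0 X) W (Cmp \<C> (T\<^sub>0 X) (T\<^sub>0 W) W w ?Tq) ?Ta"
      unfolding TwTTq by (rule T.R.cmp_assoc[symmetric]) (use Tq w a in \<open>simp_all add: arrows\<close>)
    also have "\<dots> = Cmp \<C> ?TTX X W q (Cmp \<C> ?TTX (T\<^sub>0 X) X a ?Ta)"
      unfolding wTq by (rule T.R.cmp_assoc) (use q a in \<open>simp_all add: arrows\<close>)
    also have "\<dots> = Cmp \<C> ?TTX (T\<^sub>0 X) W (Cmp \<C> (T\<^sub>0 X) (T\<^sub>0 W) W w ?Tq) (\<mu> X)"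
      unfolding a\<mu> wTq by (rule T.R.cmp_assoc[symmetric]) (use q a in \<open>simp_all add: arrows \<mu>_closed\<close>)
    also have "\<dots> = Cmp \<C> ?TTX (T\<^sub>0 W) W w (Cmp \<C> ?TTX ?TTW (T\<^sub>0 W) (\<mu> W) ?TTq)"
      unfolding \<mu>_natural[OF q] by (rule T.R.cmp_assoc) (use q Tq w in \<open>simp_all add: arrows \<mu>_closed\<close>)
    also have "\<dots> = Cmp \<C> ?TTX ?TTW W (Cmp \<C> ?TTW (T\<^sub>0 W) W w (\<mu> W)) ?TTq"
      by (rule T.R.cmp_assoc[symmetric]) (use q Tq w in \<open>simp_all add: arrows \<mu>_closed\<close>)
    finally show "Cmp \<C> ?TTX ?TTW W (Cmp \<C> ?TTW (T\<^sub>0 W) W w ?Tw) ?TTq =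
        Cmp \<C> ?TTX ?TTW W (Cmp \<C> ?TTW (T\<^sub>0 W) W w (\<mu> W)) ?TTq" .
  qed (use q Tq w in \<open>simp_all add: \<mu>_closed arrows\<close>)
  have "arr (Base E) (X, a) (W, w) q"
    using q w unit mult a a\<eta> a\<mu> wTq by (simp add: em_Obj_iff em_Hom_iff)
  from em_quotient_of_ker[OF ext this sp] show thesis
    using sp \<rho>_def by (intro that) simp_all
qed

text \<open>A quotient arrow of algebras is compared with the constructed quotient \<open>p\<close>
  of the same equivalence: \<open>q = i \<circ> p\<close> with \<open>i \<circ> j\<close> the
  identity, so a section \<open>s\<close> of \<open>p\<close> gives the section
  \<open>s \<circ> j\<close> of \<open>q\<close>.\<close>

lemma em_quotient_arrow_splits:
  assumes ext: "extensional R" and quot: "has_quotients R"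
    and ch: "\<forall>X W q. quotient_arrow R X W q \<longrightarrow> splits \<C> X W q"
    and q: "quotient_arrow E (X, a) (W, w) q"
  shows "splits \<C> X W q"
proof -
  obtain \<rho> where \<rho>: "equivalence E (X, a) \<rho>" and q': "quotient_arrow_of E (X, a) \<rho> (W, w) q"
    using q unfolding quotient_arrow_def by blast
  obtain V v p where p: "quotient_arrow_of E (X, a) \<rho> (V, v) p" and sp: "splits \<C> X V p"
    using em_quotient_exists[OF ext quot ch \<rho>] by metis
  obtain i j where i: "arr (Base E) (V, v) (W, w) i" and j: "arr (Base E) (W, w) (V, v) j"
    and ip: "Cmp (Base E) (X, a) (V, v) (W, w) i p = q"
    and ij: "Cmp (Base E) (W, w) (V, v) (W, w) i j = Ident (Base E) (W, w)"
    using EM.quotient_arrow_of_factor[OF p q'] .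
  obtain s where s: "arr \<C> V X s" "Cmp \<C> V X V p s = Ident \<C> V"
    using sp unfolding splits_def by blast
  have arrs: "arr \<C> X V p" "arr \<C> V W i" "arr \<C> W V j"
    using p i j by (auto simp: quotient_arrow_of_def em_Obj_iff em_Hom_iff)
  have "Cmp \<C> W X W q (Cmp \<C> W V X s j) = Cmp \<C> W V W i (Cmp \<C> W V V (Cmp \<C> V X V p s) j)"
    using arrs s(1) by (simp add: T.R.cmp_assoc arrows flip: ip)
  also have "\<dots> = Ident \<C> W"
    using arrs ij by (simp add: s(2) T.R.cmp_ident_left)
  finally show ?thesis
    unfolding splits_def using arrs s(1) by (intro exI[of _ "Cmp \<C> W V X s j"]) (simp add: arrows)
qed

section \<open>Free algebras as a projective cover\<close>

text \<open>A morphism out of a free algebra lifts along \<open>q\<close> by lifting its transpose along a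
  section of the underlying arrow of \<open>q\<close>.\<close>

lemma free_algebra_projective:
  assumes split: "\<And>x y q. quotient_arrow E x y q \<Longrightarrow> splits \<C> (fst x) (fst y) q"
    and A: "A \<in> Obj \<C>"
  shows "projective E (T\<^sub>0 A, \<mu> A)"
proof -
  have "\<exists>h. arr (Base E) (T\<^sub>0 A, \<mu> A) (X, a) h \<and> f = Cmp \<C> (T\<^sub>0 A) X Y q h"
    if f: "arr (Base E) (T\<^sub>0 A, \<mu> A) (Y, b) f" and q: "quotient_arrow E (X, a) (Y, b) q" for X a Y b f q
  proof -
    obtain s where s: "arr \<C> Y X s" and qs: "Cmp \<C> Y X Y q s = Ident \<C> Y"
      using split[OF q] by (auto simp: splits_def)
    have qE: "arr (Base E) (X, a) (Y, b) q"
      using q by (auto simp: quotient_arrow_def quotient_arrow_of_def)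
    have o: "arr \<C> (T\<^sub>0 X) X a" "arr \<C> (T\<^sub>0 Y) Y b" "arr \<C> X Y q" "arr \<C> (T\<^sub>0 A) Y f"
      using qE f by (simp_all add: em_Obj_iff em_Hom_iff)
    have qa: "Cmp \<C> (T\<^sub>0 X) X Y q a = Cmp \<C> (T\<^sub>0 X) (T\<^sub>0 Y) Y b (T\<^sub>1 X Y q)"
      and fb: "Cmp \<C> (T\<^sub>0 (T\<^sub>0 A)) (T\<^sub>0 A) Y f (\<mu> A) = Cmp \<C> (T\<^sub>0 (T\<^sub>0 A)) (T\<^sub>0 Y) Y b (T\<^sub>1 (T\<^sub>0 A) Y f)"
      and a\<mu>: "Cmp \<C> (T\<^sub>0 (T\<^sub>0 X)) (T\<^sub>0 X) X a (T\<^sub>1 (T\<^sub>0 X) X a) = Cmp \<C> (T\<^sub>0 (T\<^sub>0 X)) (T\<^sub>0 X) X a (\<mu> X)"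
      using qE f by (simp_all add: em_Obj_iff em_Hom_iff)
    let ?TA = "T\<^sub>0 A" and ?TTA = "T\<^sub>0 (T\<^sub>0 A)"
    have \<eta>A: "arr \<C> A ?TA (\<eta> A)" and \<mu>A: "arr \<C> ?TTA ?TA (\<mu> A)"
      using A by (simp_all add: \<eta>_closed \<mu>_closed arrows)
    \<comment> \<open>The transpose \<open>f \<circ> \<eta>\<close> is lifted along \<open>q\<close>
      in the base by means of \<open>s\<close>.\<close>
    define g where "g = Cmp \<C> A Y X s (Cmp \<C> A ?TA Y f (\<eta> A))"
    have g: "arr \<C> A X g" using s o \<eta>A by (simp add: g_def arrows)
    have qg: "Cmp \<C> A X Y q g = Cmp \<C> A ?TA Y f (\<eta> A)"
    proof -
      have "Cmp \<C> A X Y q g = Cmp \<C> A Y Y (Cmp \<C> Y X Y q s) (Cmp \<C> A ?TA Y f (\<eta> A))"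
        unfolding g_def by (rule T.R.cmp_assoc[symmetric]) (use o s \<eta>A in \<open>simp_all add: arrows\<close>)
      then show ?thesis using o \<eta>A by (simp add: qs T.R.cmp_ident_left arrows)
    qed
    \<comment> \<open>The morphism out of the free algebra that extends \<open>g\<close>.\<close>
    let ?h = "Cmp \<C> ?TA (T\<^sub>0 X) X a (T\<^sub>1 A X g)"
    have h: "arr \<C> ?TA X ?h" using g o by (simp add: arrows)
    have Tqg: "Cmp \<C> ?TA (T\<^sub>0 X) (T\<^sub>0 Y) (T\<^sub>1 X Y q) (T\<^sub>1 A X g) = Cmp \<C> ?TA ?TTA (T\<^sub>0 Y) (T\<^sub>1 ?TA Y f) (T\<^sub>1 A ?TA (\<eta> A))"
      using T.Hat.ar_cmp[OF g o(3)] T.Hat.ar_cmp[OF \<eta>A o(4)] qg by simp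
    have "Cmp \<C> ?TA X Y q ?h = Cmp \<C> ?TA (T\<^sub>0 X) Y (Cmp \<C> (T\<^sub>0 X) X Y q a) (T\<^sub>1 A X g)"
      by (rule T.R.cmp_assoc[symmetric]) (use o g in \<open>simp_all add: arrows\<close>)
    also have "\<dots> = Cmp \<C> ?TA (T\<^sub>0 Y) Y b (Cmp \<C> ?TA (T\<^sub>0 X) (T\<^sub>0 Y) (T\<^sub>1 X Y q) (T\<^sub>1 A X g))"
      unfolding qa by (rule T.R.cmp_assoc) (use o g in \<open>simp_all add: arrows\<close>)
    also have "\<dots> = Cmp \<C> ?TA ?TTA Y (Cmp \<C> ?TTA (T\<^sub>0 Y) Y b (T\<^sub>1 ?TA Y f)) (T\<^sub>1 A ?TA (\<eta> A))"
      unfolding Tqg by (rule T.R.cmp_assoc[symmetric]) (use o \<eta>A in \<open>simp_all add: arrows\<close>)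
    also have "\<dots> = Cmp \<C> ?TA ?TA Y f (Cmp \<C> ?TA ?TTA ?TA (\<mu> A) (T\<^sub>1 A ?TA (\<eta> A)))"
      unfolding fb[symmetric] by (rule T.R.cmp_assoc) (use o \<eta>A \<mu>A in \<open>simp_all add: arrows\<close>)
    also have "\<dots> = f"
      using o by (simp add: Hat.unit_right[OF A] T.R.cmp_ident_right)
    finally have qh: "Cmp \<C> ?TA X Y q ?h = f" .
    have "Cmp \<C> ?TTA ?TA X ?h (\<mu> A) = Cmp \<C> ?TTA (T\<^sub>0 X) X a (Cmp \<C> ?TTA ?TA (T\<^sub>0 X) (T\<^sub>1 A X g) (\<mu> A))"
      by (rule T.R.cmp_assoc) (use o g \<mu>A in \<open>simp_all add: arrows\<close>)
    also have "\<dots> = Cmp \<C> ?TTA (T\<^sub>0 (T\<^sub>0 X)) X (Cmp \<C> (T\<^sub>0 (T\<^sub>0 X)) (T\<^sub>0 X) X a (\<mu> X)) (T\<^sub>1 ?TA (T\<^sub>0 X) (T\<^sub>1 A X g))"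
      unfolding \<mu>_natural[OF g, symmetric]
      by (rule T.R.cmp_assoc[symmetric]) (use o g in \<open>simp_all add: arrows \<mu>_closed\<close>)
    also have "\<dots> = Cmp \<C> ?TTA (T\<^sub>0 X) X a (Cmp \<C> ?TTA (T\<^sub>0 (T\<^sub>0 X)) (T\<^sub>0 X) (T\<^sub>1 (T\<^sub>0 X) X a) (T\<^sub>1 ?TA (T\<^sub>0 X) (T\<^sub>1 A X g)))"
      unfolding a\<mu>[symmetric] by (rule T.R.cmp_assoc) (use o g in \<open>simp_all add: arrows\<close>)
    also have "\<dots> = Cmp \<C> ?TTA (T\<^sub>0 X) X a (T\<^sub>1 ?TA X ?h)"
      using T.Hat.ar_cmp[of ?TA "T\<^sub>0 X" "T\<^sub>1 A X g" X a] o g by (simp add: arrows)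
    finally have "arr (Base E) (?TA, \<mu> A) (X, a) ?h"
      using h qE free_algebra_in_Obj[OF A] by (simp add: em_Hom_iff)
    then show ?thesis using qh by blast
  qed
  then show ?thesis
    unfolding projective_def split_paired_All split_paired_Ex em_simps
    using free_algebra_in_Obj[OF A] by blast
qed

text \<open>The associativity law makes \<open>a\<close> a morphism from the free algebra, and the
  unit law makes \<eta> a section of it in the base.\<close>

lemma algebra_quotient_of_free:
  assumes ext: "extensional R" and x: "(X, a) \<in> Obj (Base E)"
  shows "quotient_arrow E (T\<^sub>0 X, \<mu> X) (X, a) a"
proof -
  have a: "arr \<C> (T\<^sub>0 X) X a" "Cmp \<C> X (T\<^sub>0 X) X a (\<eta> X) = Ident \<C> X"
    using x by (simp_all add: em_Obj_iff)
  have E: "arr (Base E) (T\<^sub>0 X, \<mu> X) (X, a) a"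
    using x free_algebra_in_Obj[of X] by (simp add: em_Hom_iff em_Obj_iff)
  have "splits \<C> (T\<^sub>0 X) X a"
    unfolding splits_def using a by (intro exI[of _ "\<eta> X"]) (simp add: \<eta>_closed)
  from em_quotient_of_ker[OF ext E this] EM.equivalence_ker[OF E] show ?thesis
    unfolding quotient_arrow_def by auto
qed

lemma projective_cover_free_algebras:
  assumes ext: "extensional R"
    and split: "\<And>x y q. quotient_arrow E x y q \<Longrightarrow> splits \<C> (fst x) (fst y) q"
  shows "projective_cover E (free_algebras \<C> (Hat T) \<eta> \<mu>)"
proof -
  have F: "free_algebras \<C> (Hat T) \<eta> \<mu> = (Base E)\<lparr>Obj := {(T\<^sub>0 X, \<mu> X) | X. X \<in> Obj \<C>}\<rparr>"
    by (simp add: free_algebras_def em_doctrine_def)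
  have "\<exists>P\<in>{(T\<^sub>0 X, \<mu> X) | X. X \<in> Obj \<C>}. \<exists>q. quotient_arrow E P x q" if "x \<in> Obj (Base E)" for x
  proof (cases x)
    case (Pair X a)
    then show ?thesis using algebra_quotient_of_free[OF ext, of X a] that
      by (auto simp: em_Obj_iff)
  qed
  moreover have "projective E P" if "P \<in> {(T\<^sub>0 X, \<mu> X) | X. X \<in> Obj \<C>}" for P
    using that free_algebra_projective[OF split] by blast
  ultimately show ?thesis
    unfolding projective_cover_def full_subcategory_def F
    using free_algebra_in_Obj by auto
qed

end

section \<open>The identity monad\<close>

context relational_doctrine
begin

lemma one_arrow_id_map: "one_arrow R R id_map"
  by unfold_locales (simp_all add: id_map_def monotone_on_def)

text \<open>The equality of records is literal, so the identity 2-arrow can serve as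
  multiplication.\<close>

lemma comp_id_map: "comp_map id_map id_map = (id_map :: ('o, 'a, 'r, 'o, 'a, 'r) doctrine_map)"
  by (simp add: comp_map_def id_map_def comp_fctr_def id_fctr_def)

lemma doctrine_monad_id: "doctrine_monad R id_map (Ident (Base R)) (Ident (Base R))"
proof -
  interpret I: one_arrow R R id_map by (rule one_arrow_id_map)
  have c: "comp_fctr id_fctr id_fctr = (id_fctr :: ('o, 'a, 'o, 'a) fctr)"
    by (simp add: comp_fctr_def id_fctr_def)
  have N: "natural_transformation (Base R) (Base R) id_fctr id_fctr (Ident (Base R))"
    using I.Hat.cat_functor_axioms unfolding id_map_simps
    by (intro natural_transformation.intro natural_transformation_axioms.intro)
      (simp_all add: closed cmp_ident_left cmp_ident_right)
  have A: "two_arrow R R id_map id_map (Ident (Base R))"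
    using I.one_arrow_axioms N
    by (intro two_arrow.intro two_arrow_axioms.intro)
      (simp_all add: id_map_simps reindex_ident leq_reflI)
  have M: "cat_monad (Base R) id_fctr (Ident (Base R)) (Ident (Base R))"
    using I.Hat.cat_functor_axioms N unfolding id_map_simps
    by (intro cat_monad.intro cat_monad_axioms.intro)
      (simp_all add: c closed cmp_ident_left)
  show ?thesis
    using I.one_arrow_axioms A M by (intro doctrine_monad.intro) (simp_all add: comp_id_map id_map_simps)
qed

text \<open>The unit law forces every structure map to be an identity, so the algebra doctrine of
  the identity monad is a copy of the original one.\<close>

lemma quotient_arrow_em_id:
  assumes "quotient_arrow R X W q"
  shows "quotient_arrow (em_doctrine R id_map (Ident (Base R)) (Ident (Base R)))
    (X, Ident (Base R) X) (W, Ident (Base R) W) q"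
proof -
  interpret M: doctrine_monad R id_map "Ident (Base R)" "Ident (Base R)"
    by (rule doctrine_monad_id)
  let ?i = "Ident (Base R)"
  have Obj: "(Y, b) \<in> Obj (Base M.E) \<longleftrightarrow> Y \<in> Obj (Base R) \<and> b = ?i Y" for Y b
    by (cases "b \<in> Hom (Base R) Y Y")
      (auto simp: M.em_Obj_iff id_map_simps closed cmp_ident_left cmp_ident_right)
  have arr: "arr (Base M.E) (Y, ?i Y) (Z, ?i Z) f \<longleftrightarrow> arr (Base R) Y Z f" for Y Z f
    by (auto simp: Obj M.em_Hom_iff id_map_simps closed cmp_ident_left cmp_ident_right)
  obtain \<rho> where \<rho>: "equivalence R X \<rho>" and q: "quotient_arrow_of R X \<rho> W q"
    using assms unfolding quotient_arrow_def by blast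
  \<comment> \<open>With identity structure maps the fibre condition reads \<rho> \<le>
    \<rho>.\<close>
  have "\<rho> \<in> Fib M.E (X, ?i X) (X, ?i X)"
    using \<rho> by (simp add: equivalence_def M.em_Fib_iff id_map_simps graph_ident conv_rid rid_left rid_right leq_reflI)
  then have "equivalence M.E (X, ?i X) \<rho>"
    using \<rho> by (simp add: equivalence_def Obj)
  moreover have "quotient_arrow_of M.E (X, ?i X) \<rho> (W, ?i W) q"
  proof -
    have "\<exists>!h. arr (Base M.E) (W, ?i W) z h \<and> f = Cmp (Base M.E) (X, ?i X) (W, ?i W) z h q"
      if f: "arr (Base M.E) (X, ?i X) z f" and le: "Leq R X X \<rho> (ker M.E (X, ?i X) z f)" for z f
    proof -
      obtain Z where z: "z = (Z, ?i Z)" using f by (cases z) (simp add: Obj)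
      show ?thesis
        using q f le unfolding z arr M.em_simps M.em_ker quotient_arrow_of_def by blast
    qed
    then show ?thesis
      using q unfolding quotient_arrow_of_def arr M.em_simps M.em_ker by blast
  qed
  ultimately show ?thesis unfolding quotient_arrow_def by blast
qed

text \<open>For the identity monad every object of the base underlies a free algebra, so
  \<open>W\<close> is projective; lifting its identity along \<open>q\<close> yields a
  section.\<close>

lemma splits_if_id_projective_cover:
  assumes cover: "projective_cover (em_doctrine R id_map (Ident (Base R)) (Ident (Base R)))
      (free_algebras (Base R) (Hat id_map) (Ident (Base R)) (Ident (Base R)))"
    and q: "quotient_arrow R X W q"
  shows "splits (Base R) X W q"
proof -
  interpret M: doctrine_monad R id_map "Ident (Base R)" "Ident (Base R)"
    by (rule doctrine_monad_id)
  let ?i = "Ident (Base R)"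
  note q' = quotient_arrow_em_id[OF q]
  have W: "W \<in> Obj (Base R)"
    using q by (auto simp: quotient_arrow_def quotient_arrow_of_def)
  then have "(W, ?i W) \<in> Obj (free_algebras (Base R) (Hat id_map) ?i ?i)"
    by (simp add: free_algebras_def id_map_def)
  then have "projective M.E (W, ?i W)"
    using cover unfolding projective_cover_def by blast
  moreover have "arr (Base M.E) (W, ?i W) (W, ?i W) (?i W)"
    using M.EM.ident_arr[of "(W, ?i W)"] q' by (auto simp: quotient_arrow_def quotient_arrow_of_def)
  ultimately obtain s where s: "arr (Base M.E) (W, ?i W) (X, ?i X) s"
    and "?i W = Cmp (Base R) W X W q s"
    using q' unfolding projective_def by (metis M.em_simps(7))
  then show ?thesis
    unfolding splits_def by (intro exI[of _ s]) (simp add: M.em_Obj_iff M.em_Hom_iff)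
qed

end

section \<open>Splitting of quotient arrows against projectivity of free algebras\<close>

theorem theorem4p16:
  fixes R :: "('o, 'a, 'r) doctrine"
  assumes "relational_doctrine R"
    and "extensional R"
    and "has_quotients R"
  shows "(\<forall>X W q. quotient_arrow R X W q \<longrightarrow> splits (Base R) X W q) \<longleftrightarrow>
    (\<forall>T \<eta> \<mu>. doctrine_monad R T \<eta> \<mu> \<longrightarrow>
       has_quotients (em_doctrine R T \<eta> \<mu>) \<and>
       projective_cover (em_doctrine R T \<eta> \<mu>) (free_algebras (Base R) (Hat T) \<eta> \<mu>))"
proof (intro iffI allI impI)
  fix T \<eta> \<mu>
  assume ch: "\<forall>X W q. quotient_arrow R X W q \<longrightarrow> splits (Base R) X W q"
    and monad: "doctrine_monad R T \<eta> \<mu>"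
  interpret doctrine_monad R T \<eta> \<mu> by (rule monad)
  have "\<exists>w q. quotient_arrow_of E x \<rho> w q \<and> effective E x \<rho> w q \<and> descent E x w q"
    if eq: "equivalence E x \<rho>" for x \<rho>
  proof -
    obtain X a where x: "x = (X, a)" by (cases x)
    obtain W w q where q: "quotient_arrow_of E (X, a) \<rho> (W, w) q" "\<rho> = ker R X W q" "splits \<C> X W q"
      using em_quotient_exists[OF assms(2,3) ch eq[unfolded x]] .
    have "descent R X W q"
      using q by (intro T.R.splits_descent) (simp_all add: quotient_arrow_of_def em_Obj_iff em_Hom_iff)
    then show ?thesis
      using q by (auto simp: x effective_def)
  qed
  then have "has_quotients E" unfolding has_quotients_def by blast
  moreover have "splits \<C> (fst x) (fst y) q" if "quotient_arrow E x y q" for x y q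
    using em_quotient_arrow_splits[OF assms(2,3) ch, of "fst x" "snd x" "fst y" "snd y"] that by simp
  ultimately show "has_quotients E \<and> projective_cover E (free_algebras \<C> (Hat T) \<eta> \<mu>)"
    using projective_cover_free_algebras[OF assms(2)] by blast
next
  fix X W q
  assume all: "\<forall>T \<eta> \<mu>. doctrine_monad R T \<eta> \<mu> \<longrightarrow>
       has_quotients (em_doctrine R T \<eta> \<mu>) \<and>
       projective_cover (em_doctrine R T \<eta> \<mu>) (free_algebras (Base R) (Hat T) \<eta> \<mu>)"
    and q: "quotient_arrow R X W q"
  interpret relational_doctrine R by (rule assms(1))
  show "splits (Base R) X W q"
    by (rule splits_if_id_projective_cover[OF conjunct2[OF all[rule_format, OF doctrine_monad_id]] q])
qed

end
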